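(* $$\pi^4\, m\big((1+v)(1+w)(1+x)+(1-v)(1-w)(y+z)\big)=93\,\zeta(5),$$ where the polynomial is in the five variables $v,w,x,y,z$.
   Context: The (logarithmic) Mahler measure of a nonzero polynomial $P\in\mathbb{C}[x_1,\dots,x_n]$ is $m(P)=\frac{1}{(2\pi i)^n}\int_{\mathbb{T}^n}\log|P(x_1,\dots,x_n)|\,\frac{dx_1}{x_1}\cdots\frac{dx_n}{x_n}$, with $\mathbb{T}^n=\{|x_1|=\dots=|x_n|=1\}$. $\zeta$ is the Riemann zeta function. *)

theory Defs
  imports "HOL-Complex_Analysis.Complex_Analysis" "HOL-Library.Poly_Mapping"
begin

text \<open>
  Polynomials over the complex numbers in the variables \<open>x\<^sub>0, x\<^sub>1, \<dots>\<close> are finitely supported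
  functions from exponent vectors to coefficients; the ring operations are the convolution
  operations of \<^theory>\<open>HOL-Library.Poly_Mapping\<close>.
\<close>

type_synonym cpoly = "(nat \<Rightarrow>\<^sub>0 nat) \<Rightarrow>\<^sub>0 complex"

definition pvar :: "nat \<Rightarrow> cpoly" where
  "pvar i = Poly_Mapping.single (Poly_Mapping.single i 1) 1"

definition meval :: "(nat \<Rightarrow> complex) \<Rightarrow> (nat \<Rightarrow>\<^sub>0 nat) \<Rightarrow> complex" where
  "meval x m = (\<Prod>i\<in>Poly_Mapping.keys m. x i ^ Poly_Mapping.lookup m i)"

definition peval :: "(nat \<Rightarrow> complex) \<Rightarrow> cpoly \<Rightarrow> complex" where
  "peval x P = (\<Sum>m\<in>Poly_Mapping.keys P. Poly_Mapping.lookup P m * meval x m)"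

lemma meval_superset:
  assumes "finite A" "Poly_Mapping.keys m \<subseteq> A"
  shows "meval x m = (\<Prod>i\<in>A. x i ^ Poly_Mapping.lookup m i)"
  unfolding meval_def using assms
  by (intro prod.mono_neutral_left) (auto simp: Poly_Mapping.in_keys_iff)

lemma meval_add: "meval x (m + m') = meval x m * meval x m'"
proof -
  let ?A = "Poly_Mapping.keys m \<union> Poly_Mapping.keys m'"
  have "Poly_Mapping.keys (m + m') \<subseteq> ?A" by (rule Poly_Mapping.keys_add)
  then show ?thesis
    using meval_superset[of ?A "m + m'" x] meval_superset[of ?A m x] meval_superset[of ?A m' x]
    by (simp add: Poly_Mapping.lookup_add power_add prod.distrib)
qed

lemma peval_superset:
  assumes "finite A" "Poly_Mapping.keys P \<subseteq> A"
  shows "peval x P = (\<Sum>m\<in>A. Poly_Mapping.lookup P m * meval x m)"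
  unfolding peval_def using assms
  by (intro sum.mono_neutral_left) (auto simp: Poly_Mapping.in_keys_iff)

lemma peval_zero [simp]: "peval x 0 = 0"
  by (simp add: peval_def)

lemma peval_single [simp]: "peval x (Poly_Mapping.single m c) = c * meval x m"
  using peval_superset[of "{m}" "Poly_Mapping.single m c" x] by simp

lemma peval_one [simp]: "peval x 1 = 1"
  using peval_single[of x 0 1] by (simp add: meval_def)

lemma peval_pvar [simp]: "peval x (pvar i) = x i"
  by (simp add: pvar_def meval_def)

lemma peval_add [simp]: "peval x (P + Q) = peval x P + peval x Q"
proof -
  let ?A = "Poly_Mapping.keys P \<union> Poly_Mapping.keys Q"
  have "Poly_Mapping.keys (P + Q) \<subseteq> ?A" by (rule Poly_Mapping.keys_add)
  then show ?thesis
    using peval_superset[of ?A "P + Q" x] peval_superset[of ?A P x] peval_superset[of ?A Q x]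
    by (simp add: lookup_add sum.distrib distrib_right)
qed

lemma peval_diff [simp]: "peval x (P - Q) = peval x P - peval x Q"
  using peval_add[of x "P - Q" Q] by simp

lemma poly_mapping_add_single_induct [case_names zero add]:
  fixes f :: "'a \<Rightarrow>\<^sub>0 'b::comm_monoid_add"
  assumes "P 0" and "\<And>a b f. P f \<Longrightarrow> P (Poly_Mapping.single a b + f)"
  shows "P f"
proof (induction f rule: Poly_Mapping.update_induct)
  case const
  show ?case by (fact assms(1))
next
  case (update f a b)
  have "Poly_Mapping.update a b f = Poly_Mapping.single a b + f"
    using update(1) by (intro poly_mapping_eqI)
      (auto simp: lookup_update lookup_add lookup_single when_def in_keys_iff)
  then show ?case using assms(2) update by simp
qed

lemma peval_mult_single:
  "peval x (Poly_Mapping.single m c * Q) = c * meval x m * peval x Q"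
  by (induction Q rule: poly_mapping_add_single_induct)
    (simp_all add: Poly_Mapping.mult_single meval_add algebra_simps)

lemma peval_mult [simp]: "peval x (P * Q) = peval x P * peval x Q"
  by (induction P rule: poly_mapping_add_single_induct)
    (simp_all add: peval_mult_single distrib_right)

text \<open>
  The integral of \<open>f(x\<^sub>0, \<dots>, x\<^sub>n\<^sub>-\<^sub>1) dx\<^sub>0 \<dots> dx\<^sub>n\<^sub>-\<^sub>1\<close> over the \<open>n\<close>-torus, each unit circle being
  parametrized by \<^term>\<open>circlepath 0 1\<close>, that is, by \<open>t \<mapsto> exp (2\<pi>it)\<close> for \<open>0 \<le> t \<le> 1\<close>.
\<close>

definition torus_integral :: "nat \<Rightarrow> ((nat \<Rightarrow> complex) \<Rightarrow> complex) \<Rightarrow> complex" where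
  "torus_integral n f =
     (LINT t:({..<n} \<rightarrow>\<^sub>E {0..1::real}) | (\<Pi>\<^sub>M i\<in>{..<n}. lborel).
        f (\<lambda>i. circlepath 0 1 (t i)) *
        (\<Prod>i<n. vector_derivative (circlepath 0 1) (at (t i))))"

text \<open>
  The Mahler measure of \<open>P\<close> as a polynomial in \<open>x\<^sub>0, \<dots>, x\<^sub>n\<^sub>-\<^sub>1\<close>; only meant for nonzero \<open>P\<close>
  without further variables. Where \<open>P\<close> vanishes on the torus, the convention \<open>ln 0 = 0\<close> is
  harmless, since this is a null set. The value is real, see \<open>mahler_measure_eq\<close> below.
\<close>

definition mahler_measure :: "nat \<Rightarrow> cpoly \<Rightarrow> complex" where
  "mahler_measure n P =
     1 / (2 * of_real pi * \<i>) ^ n *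
     torus_integral n (\<lambda>x. of_real (ln (norm (peval x P))) * (\<Prod>i<n. 1 / x i))"

lemma mahler_measure_eq:
  "mahler_measure n P =
     of_real (LINT t:({..<n} \<rightarrow>\<^sub>E {0..1}) | (\<Pi>\<^sub>M i\<in>{..<n}. lborel).
       ln (norm (peval (\<lambda>i. exp (2 * of_real pi * \<i> * of_real (t i))) P)))"
proof -
  have c: "circlepath 0 1 s = exp (2 * of_real pi * \<i> * of_real s)" for s
    by (simp add: circlepath)
  have d: "vector_derivative (circlepath 0 1) (at s) =
      2 * of_real pi * \<i> * exp (2 * of_real pi * \<i> * of_real s)" for s
    by (simp add: vector_derivative_circlepath)
  have e: "(\<Prod>i<n. 1 / circlepath 0 1 (t i)) *
      (\<Prod>i<n. vector_derivative (circlepath 0 1) (at (t i))) = (2 * of_real pi * \<i>) ^ n"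
    for t :: "nat \<Rightarrow> real"
    by (simp only: c d prod.distrib [symmetric]) simp
  show ?thesis
    unfolding mahler_measure_def torus_integral_def mult.assoc e
    unfolding c set_integral_mult_left set_integral_complex_of_real
    by (simp add: mult.assoc)
qed

text \<open>
  The Dirichlet series of the Riemann zeta function, which defines it for \<open>Re s > 1\<close>; outside
  this half-plane the constant does not denote the analytic continuation.
\<close>

definition zeta :: "complex \<Rightarrow> complex" where
  "zeta s = suminf (\<lambda>n. 1 / of_nat (Suc n) powr s)"

end

theory Submission
  imports Defs "HOL-Probability.Distributions"
begin

text \<open>
  Write \<open>E\<close> for the mean over independent uniform points \<open>v, w, x, y, z\<close> of the unit circle.
  Replacing \<open>y\<close> by the product \<open>yz\<close> does not change the mean and turns the polynomial into \<open>A + Bz\<close> with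
  \<open>A = (1 + v)(1 + w)(1 + x)\<close> and \<open>B = (1 - v)(1 - w)(1 + y)\<close>. Jensen's formula
  \<open>E ln |a + bz| = max (ln |a|) (ln |b|)\<close> integrates \<open>z\<close> away, so the Mahler measure is
  \<open>E max (ln |A|) (ln |B|)\<close>. Jensen's formula for \<open>1 + z\<close> and \<open>1 - z\<close> also says that \<open>ln |A|\<close> and
  \<open>ln |B|\<close> have mean zero; as \<open>max p q = (p + q + |p - q|) / 2\<close>, what is left is
  \<open>E |L + L' + R| / 2\<close>, where \<open>L = ln |(1 + v) / (1 - v)|\<close>, \<open>L' = ln |(1 + w) / (1 - w)|\<close> and
  \<open>R = ln |(1 + x) / (1 + y)|\<close> are independent.

  The first of these is the logarithm of a Cauchy variable and has the density \<open>1 / (\<pi> cosh u)\<close>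
  (\<open>nn_integral_log_cot\<close>). The heart of the proof is the law of \<open>L + R\<close>: its density at \<open>s\<close> is
  \<open>4/\<pi>\<^sup>3\<close> times the integral of \<open>u / cosh u\<close> over \<open>u > |s|\<close> (\<open>nn_integral_sech_shift\<close>). This form
  of the density turns \<open>E |L + R + c|\<close> into a single integral against \<open>u / cosh u\<close>, with an
  elementary kernel that is piecewise quadratic in \<open>u\<close> and \<open>c\<close>. Averaging over \<open>c = L'\<close> and
  symmetrizing in \<open>u\<close> and \<open>c\<close> makes the kernel a cube,
  \<open>E |L + L' + R| = 1/\<pi>\<^sup>4 \<cdot> \<integral>\<integral> |u + c|\<^sup>3 / (cosh u \<cdot> cosh c) du dc\<close>,
  and since the convolution of \<open>1 / cosh\<close> with itself is \<open>2d / sinh d\<close>, this is \<open>4/\<pi>\<^sup>4\<close> times the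
  integral of \<open>d\<^sup>4 / sinh d\<close> over \<open>d > 0\<close>, which is \<open>93/2 \<cdot> \<zeta>(5)\<close> by the expansion of \<open>1 / sinh d\<close> in powers of
  \<open>exp (-d)\<close>.

  All integrals are taken of nonnegative functions, so that Tonelli's theorem applies without
  any integrability condition; to this end \<open>ln |P|\<close> is replaced by \<open>C - ln |P|\<close>, where \<open>C\<close> bounds
  \<open>ln |P|\<close>. Integrability of \<open>ln |P|\<close> on the torus is then part of the result.
\<close>

section \<open>The uniform distribution on the unit interval and changes of variables\<close>

text \<open>
  The whole line is exhausted by the intervals \<open>[-n, n]\<close>, on which the substitution rule for
  compact intervals applies; both sides converge monotonically.
\<close>

lemma nn_integral_substitution_line:
  fixes f :: "real \<Rightarrow> ennreal" and g g' :: "real \<Rightarrow> real"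
  assumes [measurable]: "f \<in> borel_measurable borel"
    and deriv: "\<And>x. (g has_real_derivative g' x) (at x)"
    and cont: "continuous_on UNIV g'" and pos: "\<And>x. g' x > 0"
    and lim_bot: "(g \<longlongrightarrow> A) at_bot" and lim_top: "(g \<longlongrightarrow> B) at_top"
  shows "(\<integral>\<^sup>+x. f x * indicator {A<..<B} x \<partial>lborel) = (\<integral>\<^sup>+x. f (g x) * ennreal (g' x) \<partial>lborel)"
proof -
  have mono: "strict_mono g"
  proof (rule strict_monoI)
    fix x y :: real assume "x < y"
    then show "g x < g y" using DERIV_pos_imp_increasing[of x y g] deriv pos by blast
  qed
  have cont_g: "continuous_on UNIV g"
    using deriv by (meson DERIV_continuous continuous_at_imp_continuous_on)
  have [measurable]: "g \<in> borel_measurable borel" "g' \<in> borel_measurable borel"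
    using cont cont_g by (auto intro: borel_measurable_continuous_onI)
  have gA: "A < g x" for x
  proof -
    have "A \<le> g (x - 1)"
      by (rule tendsto_upperbound[OF lim_bot])
        (auto simp: eventually_at_bot_linorder strict_mono_less_eq[OF mono] intro!: exI[of _ "x - 1"])
    also have "\<dots> < g x" using mono by (simp add: strict_mono_less)
    finally show ?thesis .
  qed
  have gB: "g x < B" for x
  proof -
    have "g x < g (x + 1)" using mono by (simp add: strict_mono_less)
    also have "g (x + 1) \<le> B"
      by (rule tendsto_lowerbound[OF lim_top])
        (auto simp: eventually_at_top_linorder strict_mono_less_eq[OF mono] intro!: exI[of _ "x + 1"])
    finally show ?thesis .
  qed
  let ?l = "\<lambda>n x. f x * indicator {g (- real (Suc n))..g (real (Suc n))} x"
  let ?r = "\<lambda>n x. f (g x) * ennreal (g' x) * indicator {- real (Suc n)..real (Suc n)} x"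
  have eq: "integral\<^sup>N lborel (?l n) = integral\<^sup>N lborel (?r n)" for n
    by (rule nn_integral_substitution_aux[where g = g and g' = g'])
      (use deriv pos cont in \<open>auto intro: continuous_on_subset less_imp_le\<close>)
  have inc: "incseq (\<lambda>n. indicator (S n) x :: ennreal)"
    if "\<And>n. S n \<subseteq> S (Suc n)" for S :: "nat \<Rightarrow> real set" and x
    by (rule incseq_SucI) (use that in \<open>auto simp: indicator_def\<close>)
  have "(\<lambda>n. integral\<^sup>N lborel (?l n)) \<longlonglongrightarrow> (\<integral>\<^sup>+x. f x * indicator {A<..<B} x \<partial>lborel)"
  proof (rule nn_integral_LIMSEQ)
    show "incseq ?l"
    proof (rule incseq_SucI, rule le_funI, rule mult_left_mono)
      fix n x
      have "g (- real (Suc (Suc n))) \<le> g (- real (Suc n))" "g (real (Suc n)) \<le> g (real (Suc (Suc n)))"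
        by (simp_all add: strict_mono_less_eq[OF mono])
      then show "indicator {g (- real (Suc n))..g (real (Suc n))} x
        \<le> (indicator {g (- real (Suc (Suc n)))..g (real (Suc (Suc n)))} x :: ennreal)"
        by (auto simp: indicator_def)
    qed auto
    show "(\<lambda>n. ?l n x) \<longlonglongrightarrow> f x * indicator {A<..<B} x" for x
    proof (cases "x \<in> {A<..<B}")
      case True
      have 1: "\<forall>\<^sub>F y in at_bot. g y < x" "\<forall>\<^sub>F y in at_top. x < g y"
        using order_tendstoD(2)[OF lim_bot, of x] order_tendstoD(1)[OF lim_top, of x] True by auto
      have 2: "filterlim (\<lambda>n. real (Suc n)) at_top sequentially"
        by (rule filterlim_compose[OF filterlim_real_sequentially filterlim_Suc])
      have 3: "filterlim (\<lambda>n. - real (Suc n)) at_bot sequentially"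
        using 2 by (rule filterlim_compose[OF filterlim_uminus_at_bot_at_top])
      have "\<forall>\<^sub>F n in sequentially. ?l n x = f x * indicator {A<..<B} x"
        using eventually_compose_filterlim[OF 1(1) 3] eventually_compose_filterlim[OF 1(2) 2]
        by eventually_elim (use True in auto)
      then show ?thesis by (rule tendsto_eventually)
    next
      case False
      have "x \<notin> {g (- real (Suc n))..g (real (Suc n))}" for n
        using False gA[of "- real (Suc n)"] gB[of "real (Suc n)"] by auto
      then show ?thesis using False by simp
    qed
  qed simp
  moreover have "(\<lambda>n. integral\<^sup>N lborel (?r n)) \<longlonglongrightarrow> (\<integral>\<^sup>+x. f (g x) * ennreal (g' x) \<partial>lborel)"
  proof (rule nn_integral_LIMSEQ)
    show "incseq ?r"
      by (rule incseq_SucI, rule le_funI, rule mult_left_mono) (auto simp: indicator_def)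
    show "(\<lambda>n. ?r n x) \<longlonglongrightarrow> f (g x) * ennreal (g' x)" for x
    proof -
      obtain N :: nat where "\<bar>x\<bar> \<le> real N" using real_arch_simple by blast
      then have "\<forall>\<^sub>F n in sequentially. ?r n x = f (g x) * ennreal (g' x)"
        by (intro eventually_sequentiallyI[of N]) (auto simp: indicator_def)
      then show ?thesis by (rule tendsto_eventually)
    qed
  qed simp
  ultimately show ?thesis
    unfolding eq by (rule LIMSEQ_unique)
qed

lemma AE_lborel_neq: "AE x in lborel. x \<noteq> (a::real)"
  by (rule AE_lborel_singleton)

lemma nn_integral_Ioo_eq_Icc:
  fixes f :: "real \<Rightarrow> ennreal"
  shows "(\<integral>\<^sup>+x. f x * indicator {a<..<b} x \<partial>lborel) = (\<integral>\<^sup>+x. f x * indicator {a..b} x \<partial>lborel)"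
  by (rule nn_integral_cong_AE, rule AE_mp[OF AE_lborel_neq[of a]], rule AE_mp[OF AE_lborel_neq[of b]])
    (auto simp: indicator_def)

lemma nn_integral_even:
  fixes f :: "real \<Rightarrow> ennreal"
  assumes [measurable]: "f \<in> borel_measurable borel" and even: "\<And>x. f (- x) = f x"
  shows "(\<integral>\<^sup>+x. f x \<partial>lborel) = 2 * (\<integral>\<^sup>+x. f x * indicator {0<..} x \<partial>lborel)"
proof -
  have "(\<integral>\<^sup>+x. f x \<partial>lborel) = (\<integral>\<^sup>+x. f x * indicator {0<..} x + f x * indicator {..<0} x \<partial>lborel)"
    by (rule nn_integral_cong_AE, rule AE_mp[OF AE_lborel_neq[of 0]]) (auto simp: indicator_def)
  also have "\<dots> = (\<integral>\<^sup>+x. f x * indicator {0<..} x \<partial>lborel) + (\<integral>\<^sup>+x. f x * indicator {..<0} x \<partial>lborel)"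
    by (rule nn_integral_add) measurable
  also have "(\<integral>\<^sup>+x. f x * indicator {..<0} x \<partial>lborel) = (\<integral>\<^sup>+x. f x * indicator {0<..} x \<partial>lborel)"
    by (subst nn_integral_real_affine[where c = "-1" and t = 0])
      (auto simp: even indicator_def intro!: nn_integral_cong)
  finally show ?thesis by (simp add: mult_2)
qed

text \<open>
  As a density over \<open>lborel\<close> rather than a restriction of it, the measure has all of \<open>\<real>\<close> as its
  space and the Borel sets as its \<open>\<sigma>\<close>-algebra, so that measurability over it is plain Borel
  measurability.
\<close>

definition unif :: "real measure" where
  "unif = density lborel (indicator {0..1})"

lemma sets_unif [measurable_cong, simp]: "sets unif = sets borel"
  by (simp add: unif_def)

lemma space_unif [simp]: "space unif = UNIV"
  by (simp add: unif_def)

lemma nn_integral_unif: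
  assumes [measurable]: "f \<in> borel_measurable borel"
  shows "(\<integral>\<^sup>+t. f t \<partial>unif) = (\<integral>\<^sup>+t. f t * indicator {0..1} t \<partial>lborel)"
  unfolding unif_def by (subst nn_integral_density) (auto simp: mult.commute)

interpretation unif: prob_space unif
  by standard (simp add: unif_def emeasure_density)

interpretation unif_pair: pair_sigma_finite unif unif ..

interpretation unif_lborel: pair_sigma_finite unif lborel ..

text \<open>
  The functions of \<open>t\<close> that occur depend on \<open>|cos (\<pi>t)|\<close> and \<open>|sin (\<pi>t)|\<close> only, hence are symmetric about \<open>1/2\<close>;
  folding there makes the angle \<open>\<pi>t\<close> run through the first quadrant.
\<close>

lemma nn_integral_unif_fold:
  fixes f :: "real \<Rightarrow> ennreal"
  assumes [measurable]: "f \<in> borel_measurable borel" and sym: "\<And>t. f (1 - t) = f t"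
  shows "(\<integral>\<^sup>+t. f t \<partial>unif) = ennreal (2 / pi) * (\<integral>\<^sup>+x. f (x / pi) * indicator {0<..<pi/2} x \<partial>lborel)"
proof -
  let ?I = "\<integral>\<^sup>+t. f t * indicator {0<..<1/2} t \<partial>lborel"
  have "(\<integral>\<^sup>+t. f t \<partial>unif) =
      (\<integral>\<^sup>+t. f t * indicator {0<..<1/2} t + f t * indicator {1/2<..<1} t \<partial>lborel)"
    unfolding nn_integral_unif[OF assms(1)]
    by (rule nn_integral_cong_AE)
      (use AE_lborel_neq[of 0] AE_lborel_neq[of "1/2"] AE_lborel_neq[of 1]
       in \<open>eventually_elim, auto simp: indicator_def\<close>)
  also have "\<dots> = ?I + (\<integral>\<^sup>+t. f t * indicator {1/2<..<1} t \<partial>lborel)"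
    by (rule nn_integral_add) auto
  also have "(\<integral>\<^sup>+t. f t * indicator {1/2<..<1} t \<partial>lborel) = ?I"
    by (subst nn_integral_real_affine[where c = "-1" and t = 1])
      (auto simp: sym intro!: nn_integral_cong simp: indicator_def)
  also have "?I = ennreal (1 / pi) * (\<integral>\<^sup>+x. f (x / pi) * indicator {0<..<pi/2} x \<partial>lborel)"
    by (subst nn_integral_real_affine[where c = "1 / pi" and t = 0])
      (auto intro!: arg_cong2[where f = "(*)"] nn_integral_cong simp: indicator_def field_simps)
  finally show ?thesis
    by (simp add: distrib_right[symmetric] ennreal_plus[symmetric] del: ennreal_plus)
qed

lemma nn_integral_unif_rotate:
  fixes f :: "real \<Rightarrow> ennreal"
  assumes [measurable]: "f \<in> borel_measurable borel" and per: "\<And>t. f (t + 1) = f t" and c: "0 \<le> c" "c \<le> 1"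
  shows "(\<integral>\<^sup>+t. f (t + c) \<partial>unif) = (\<integral>\<^sup>+t. f t \<partial>unif)"
proof -
  have "(\<integral>\<^sup>+t. f (t + c) \<partial>unif) = (\<integral>\<^sup>+t. f t * indicator {c..1 + c} t \<partial>lborel)"
    unfolding nn_integral_unif[OF assms(1)]
    by (subst nn_integral_unif, simp, subst nn_integral_real_affine[where c = 1 and t = "- c"])
      (auto simp: indicator_def intro!: nn_integral_cong)
  also have "\<dots> = (\<integral>\<^sup>+t. f t * indicator {c..1} t + f t * indicator {1<..1+c} t \<partial>lborel)"
    by (intro nn_integral_cong) (use c in \<open>auto simp: indicator_def\<close>)
  also have "\<dots> = (\<integral>\<^sup>+t. f t * indicator {c..1} t \<partial>lborel) + (\<integral>\<^sup>+t. f t * indicator {1<..1+c} t \<partial>lborel)"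
    by (rule nn_integral_add) auto
  also have "(\<integral>\<^sup>+t. f t * indicator {1<..1+c} t \<partial>lborel) = (\<integral>\<^sup>+t. f t * indicator {0<..c} t \<partial>lborel)"
    by (subst nn_integral_real_affine[where c = 1 and t = 1])
      (auto simp: indicator_def per add.commute[of 1] intro!: nn_integral_cong)
  also have "(\<integral>\<^sup>+t. f t * indicator {c..1} t \<partial>lborel) + \<dots> =
      (\<integral>\<^sup>+t. f t * indicator {c..1} t + f t * indicator {0<..c} t \<partial>lborel)"
    by (rule nn_integral_add[symmetric]) auto
  also have "\<dots> = (\<integral>\<^sup>+t. f t * indicator {0..1} t \<partial>lborel)"
    by (rule nn_integral_cong_AE)
      (rule AE_mp[OF AE_lborel_neq[of 0]], rule AE_mp[OF AE_lborel_neq[of c]],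
        use c in \<open>auto simp: indicator_def\<close>)
  finally show ?thesis by (simp add: nn_integral_unif)
qed

lemma nn_integral_unif_abs_cos:
  assumes [measurable]: "F \<in> borel_measurable borel"
  shows "(\<integral>\<^sup>+t. F \<bar>cos (pi * t)\<bar> \<partial>unif) =
    ennreal (2 / pi) * (\<integral>\<^sup>+x. F (cos x) * indicator {0<..<pi/2} x \<partial>lborel)"
proof -
  have "(\<integral>\<^sup>+t. F \<bar>cos (pi * t)\<bar> \<partial>unif) =
      ennreal (2 / pi) * (\<integral>\<^sup>+x. F \<bar>cos (pi * (x / pi))\<bar> * indicator {0<..<pi/2} x \<partial>lborel)"
    by (rule nn_integral_unif_fold) (simp_all add: right_diff_distrib cos_diff)
  also have "(\<integral>\<^sup>+x. F \<bar>cos (pi * (x / pi))\<bar> * indicator {0<..<pi/2} x \<partial>lborel) =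
      (\<integral>\<^sup>+x. F (cos x) * indicator {0<..<pi/2} x \<partial>lborel)"
    by (intro nn_integral_cong) (auto simp: indicator_def cos_gt_zero abs_of_pos)
  finally show ?thesis .
qed

text \<open>
  This peels a chosen coordinate off an integral over a unit cube. Since the remaining
  coordinates form a cube again, repeated use gives the iterated integral in any desired order.
\<close>

lemma nn_integral_PiM_unit_cube_insert:
  fixes g :: "(nat \<Rightarrow> real) \<Rightarrow> ennreal"
  assumes I: "finite I" "i \<notin> I"
    and [measurable]: "g \<in> borel_measurable (Pi\<^sub>M (insert i I) (\<lambda>_. lborel))"
  shows "(\<integral>\<^sup>+t. g t * (\<Prod>j\<in>insert i I. indicator {0..1} (t j)) \<partial>Pi\<^sub>M (insert i I) (\<lambda>_. lborel)) =
    (\<integral>\<^sup>+y. \<integral>\<^sup>+t. g (t(i := y)) * (\<Prod>j\<in>I. indicator {0..1} (t j)) \<partial>Pi\<^sub>M I (\<lambda>_. lborel) \<partial>unif)"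
proof -
  interpret product_sigma_finite "\<lambda>_::nat. lborel :: real measure" ..
  interpret I: finite_product_sigma_finite "\<lambda>_::nat. lborel :: real measure" I by standard (rule I)
  have "(\<integral>\<^sup>+t. g t * (\<Prod>j\<in>insert i I. indicator {0..1} (t j)) \<partial>Pi\<^sub>M (insert i I) (\<lambda>_. lborel)) =
      (\<integral>\<^sup>+y. \<integral>\<^sup>+t. g (t(i := y)) * (\<Prod>j\<in>insert i I. indicator {0..1} ((t(i := y)) j)) \<partial>Pi\<^sub>M I (\<lambda>_. lborel) \<partial>lborel)"
    by (rule product_nn_integral_insert_rev[OF I]) measurable
  also have "\<dots> = (\<integral>\<^sup>+y. (\<integral>\<^sup>+t. g (t(i := y)) * (\<Prod>j\<in>I. indicator {0..1} (t j)) \<partial>Pi\<^sub>M I (\<lambda>_. lborel)) * indicator {0..1} y \<partial>lborel)"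
  proof (rule nn_integral_cong)
    fix y :: real
    have "(\<Prod>j\<in>insert i I. indicator {0..1} ((t(i := y)) j)) = (\<Prod>j\<in>I. indicator {0..1} (t j)) * (indicator {0..1} y :: ennreal)" for t
    proof -
      have "(\<Prod>j\<in>I. indicator {0..1} ((t(i := y)) j)) = (\<Prod>j\<in>I. indicator {0..1} (t j) :: ennreal)"
        by (intro prod.cong) (use I in auto)
      then show ?thesis using I by (simp add: mult.commute)
    qed
    then show "(\<integral>\<^sup>+t. g (t(i := y)) * (\<Prod>j\<in>insert i I. indicator {0..1} ((t(i := y)) j)) \<partial>Pi\<^sub>M I (\<lambda>_. lborel)) =
        (\<integral>\<^sup>+t. g (t(i := y)) * (\<Prod>j\<in>I. indicator {0..1} (t j)) \<partial>Pi\<^sub>M I (\<lambda>_. lborel)) * indicator {0..1} y"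
      by (subst nn_integral_multc[symmetric]) (simp_all add: mult.assoc)
  qed
  also have "\<dots> = (\<integral>\<^sup>+y. \<integral>\<^sup>+t. g (t(i := y)) * (\<Prod>j\<in>I. indicator {0..1} (t j)) \<partial>Pi\<^sub>M I (\<lambda>_. lborel) \<partial>unif)"
    by (rule nn_integral_unif[symmetric]) measurable
  finally show ?thesis .
qed

text \<open>
  The order of the iterated integrals on the right is the one in which the variables of the
  polynomial are eliminated: the last two coordinates come innermost, and the second one
  comes outermost.
\<close>

lemma nn_integral_unit_cube_5:
  fixes F :: "real \<Rightarrow> real \<Rightarrow> real \<Rightarrow> real \<Rightarrow> real \<Rightarrow> ennreal"
  assumes [measurable]: "(\<lambda>(a, b, c, d, e). F a b c d e) \<in>
    borel_measurable (borel \<Otimes>\<^sub>M borel \<Otimes>\<^sub>M borel \<Otimes>\<^sub>M borel \<Otimes>\<^sub>M borel)"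
  shows "(\<integral>\<^sup>+t. F (t 0) (t 1) (t 2) (t 3) (t 4) * indicator ({..<5} \<rightarrow>\<^sub>E {0..1}) t \<partial>Pi\<^sub>M {..<5::nat} (\<lambda>_. lborel)) =
    (\<integral>\<^sup>+b. \<integral>\<^sup>+c. \<integral>\<^sup>+a. \<integral>\<^sup>+d. \<integral>\<^sup>+e. F a b c d e \<partial>unif \<partial>unif \<partial>unif \<partial>unif \<partial>unif)"
proof -
  have F_meas: "(\<lambda>t. F (f0 t) (f1 t) (f2 t) (f3 t) (f4 t)) \<in> borel_measurable M"
    if [measurable]: "f0 \<in> borel_measurable M" "f1 \<in> borel_measurable M" "f2 \<in> borel_measurable M"
      "f3 \<in> borel_measurable M" "f4 \<in> borel_measurable M" for f0 f1 f2 f3 f4 and M :: "(nat \<Rightarrow> real) measure"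
    using measurable_compose[OF _ assms, of "\<lambda>t. (f0 t, f1 t, f2 t, f3 t, f4 t)" M] by simp
  have comp: "(\<lambda>t. t j) \<in> borel_measurable (Pi\<^sub>M I (\<lambda>_. lborel :: real measure))"
    if "j \<in> I" for j :: nat and I
    using measurable_component_singleton[OF that, of "\<lambda>_. lborel :: real measure"] by simp
  have set5: "{..<5::nat} = {1, 2, 0, 3, 4}" by auto
  have "(\<integral>\<^sup>+t. F (t 0) (t 1) (t 2) (t 3) (t 4) * indicator ({..<5} \<rightarrow>\<^sub>E {0..1}) t \<partial>Pi\<^sub>M {..<5::nat} (\<lambda>_. lborel)) =
      (\<integral>\<^sup>+t. F (t 0) (t 1) (t 2) (t 3) (t 4) * (\<Prod>j<5. indicator {0..1} (t j)) \<partial>Pi\<^sub>M {..<5::nat} (\<lambda>_. lborel))"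
  proof (rule nn_integral_cong)
    fix t :: "nat \<Rightarrow> real"
    assume "t \<in> space (Pi\<^sub>M {..<5::nat} (\<lambda>_. lborel))"
    then have "t \<in> extensional {..<5}" by (simp add: space_PiM PiE_def)
    then have "indicator ({..<5} \<rightarrow>\<^sub>E {0..1}) t = (\<Prod>j<5. indicator {0..1} (t j) :: ennreal)"
      by (cases "\<forall>j<5. t j \<in> {0..1}") (auto simp: indicator_def PiE_iff)
    then show "F (t 0) (t 1) (t 2) (t 3) (t 4) * indicator ({..<5} \<rightarrow>\<^sub>E {0..1}) t =
        F (t 0) (t 1) (t 2) (t 3) (t 4) * (\<Prod>j<5. indicator {0..1} (t j))" by simp
  qed
  also have "\<dots> = (\<integral>\<^sup>+b. \<integral>\<^sup>+t. F (t 0) b (t 2) (t 3) (t 4) * (\<Prod>j\<in>{2::nat, 0, 3, 4}. indicator {0..1} (t j))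
      \<partial>Pi\<^sub>M {2, 0, 3, 4} (\<lambda>_. lborel) \<partial>unif)"
    unfolding set5 by (subst nn_integral_PiM_unit_cube_insert) (simp, simp, (intro F_meas comp measurable_const; simp), simp del: prod.insert)
  also have "\<dots> = (\<integral>\<^sup>+b. \<integral>\<^sup>+c. \<integral>\<^sup>+t. F (t 0) b c (t 3) (t 4) * (\<Prod>j\<in>{0::nat, 3, 4}. indicator {0..1} (t j))
      \<partial>Pi\<^sub>M {0, 3, 4} (\<lambda>_. lborel) \<partial>unif \<partial>unif)"
    by (rule nn_integral_cong, subst nn_integral_PiM_unit_cube_insert) (simp, simp, (intro F_meas comp measurable_const; simp), simp del: prod.insert)
  also have "\<dots> = (\<integral>\<^sup>+b. \<integral>\<^sup>+c. \<integral>\<^sup>+a. \<integral>\<^sup>+t. F a b c (t 3) (t 4) * (\<Prod>j\<in>{3::nat, 4}. indicator {0..1} (t j))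
      \<partial>Pi\<^sub>M {3, 4} (\<lambda>_. lborel) \<partial>unif \<partial>unif \<partial>unif)"
    by (rule nn_integral_cong, rule nn_integral_cong, subst nn_integral_PiM_unit_cube_insert) (simp, simp, (intro F_meas comp measurable_const; simp), simp del: prod.insert)
  also have "\<dots> = (\<integral>\<^sup>+b. \<integral>\<^sup>+c. \<integral>\<^sup>+a. \<integral>\<^sup>+d. \<integral>\<^sup>+t. F a b c d (t 4) * (\<Prod>j\<in>{4::nat}. indicator {0..1} (t j))
      \<partial>Pi\<^sub>M {4} (\<lambda>_. lborel) \<partial>unif \<partial>unif \<partial>unif \<partial>unif)"
    by (rule nn_integral_cong, rule nn_integral_cong, rule nn_integral_cong,
        subst nn_integral_PiM_unit_cube_insert) (simp, simp, (intro F_meas comp measurable_const; simp), simp del: prod.insert)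
  also have "\<dots> = (\<integral>\<^sup>+b. \<integral>\<^sup>+c. \<integral>\<^sup>+a. \<integral>\<^sup>+d. \<integral>\<^sup>+e. F a b c d e \<partial>unif \<partial>unif \<partial>unif \<partial>unif \<partial>unif)"
    by (rule nn_integral_cong, rule nn_integral_cong, rule nn_integral_cong, rule nn_integral_cong,
        subst nn_integral_PiM_unit_cube_insert) (simp, simp, (intro F_meas comp measurable_const; simp), simp add: PiM_empty emeasure_count_space)
  finally show ?thesis .
qed

section \<open>The unit circle and Jensen's formula\<close>

definition circ :: "real \<Rightarrow> complex" where
  "circ t = exp (2 * of_real pi * \<i> * of_real t)"

lemma norm_circ [simp]: "norm (circ t) = 1"
  by (simp add: circ_def)

lemma circ_cis: "circ t = cis (2 * pi * t)"
  by (simp add: circ_def cis_conv_exp mult_ac)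

lemma circ_add: "circ (s + t) = circ s * circ t"
  by (simp add: circ_cis cis_mult algebra_simps)

lemma circ_1 [simp]: "circ 1 = 1"
  by (simp add: circ_cis)

lemma measurable_circ [measurable]: "circ \<in> borel_measurable borel"
  unfolding circ_def by (intro borel_measurable_continuous_onI continuous_intros)

lemma norm_one_plus_circ: "norm (1 + circ t) = 2 * \<bar>cos (pi * t)\<bar>"
proof -
  have "(norm (1 + circ t))\<^sup>2 = (1 + cos (2 * (pi * t)))\<^sup>2 + (sin (2 * (pi * t)))\<^sup>2"
    by (simp add: cmod_power2 circ_cis mult.assoc)
  also have "\<dots> = 2 + 2 * cos (2 * (pi * t))"
    by (simp add: sin_squared_eq power2_sum)
  also have "\<dots> = (2 * \<bar>cos (pi * t)\<bar>)\<^sup>2"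
    by (simp add: cos_double_cos power_mult_distrib)
  finally show ?thesis by (rule power2_eq_imp_eq) auto
qed

lemma norm_one_minus_circ: "norm (1 - circ t) = 2 * \<bar>sin (pi * t)\<bar>"
proof -
  have "(norm (1 - circ t))\<^sup>2 = (1 - cos (2 * (pi * t)))\<^sup>2 + (sin (2 * (pi * t)))\<^sup>2"
    by (simp add: cmod_power2 circ_cis mult.assoc)
  also have "\<dots> = 2 - 2 * cos (2 * (pi * t))"
    by (simp add: sin_squared_eq power2_diff)
  also have "\<dots> = (2 * \<bar>sin (pi * t)\<bar>)\<^sup>2"
    by (simp add: cos_double_sin power_mult_distrib)
  finally show ?thesis by (rule power2_eq_imp_eq) auto
qed

text \<open>
  The circle is parametrized by full turns, so two parameters of a point differ by an integer.
\<close>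

lemma finite_circ_eq: "finite {t \<in> {0..1}. circ t = a}"
proof (cases "\<exists>u\<in>{0..1}. circ u = a")
  case True
  then obtain u where u: "u \<in> {0..1}" "circ u = a" by blast
  have "{t \<in> {0..1}. circ t = a} \<subseteq> {u - 1, u, u + 1}"
  proof (rule subsetI, rule ccontr)
    fix t assume t: "t \<in> {t \<in> {0..1}. circ t = a}" "t \<notin> {u - 1, u, u + 1}"
    have "cis (2 * pi * t) = cis (2 * pi * u)" using t u by (simp add: circ_cis)
    then obtain n :: int where "2 * pi * t = 2 * pi * u + 2 * pi * n"
      unfolding cis.code complex.inject using sin_cos_eq_iff by metis
    then have "t = u + n" by (simp flip: distrib_left)
    moreover have "n \<in> {-1, 0, 1}" using \<open>t = u + n\<close> t(1) u(1) by auto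
    ultimately show False using t by auto
  qed
  then show ?thesis by (rule finite_subset) auto
next
  case False
  then have "{t \<in> {0..1}. circ t = a} = {}" by blast
  then show ?thesis by (simp only: finite.emptyI)
qed

lemma AE_unif_circ_neq: "AE t in unif. circ t \<noteq> a"
proof -
  have "AE t in lborel. t \<notin> {t \<in> {0..1}. circ t = a}"
    by (intro AE_not_in finite_imp_null_set_lborel finite_circ_eq)
  then show ?thesis unfolding unif_def by (subst AE_density) (auto simp: indicator_def)
qed

lemma AE_unif_cos_sin_neq: "AE t in unif. cos (pi * t) \<noteq> 0 \<and> sin (pi * t) \<noteq> 0"
  using AE_unif_circ_neq[of "- 1"] AE_unif_circ_neq[of 1]
proof eventually_elim
  case (elim t)
  then have "norm (1 + circ t) \<noteq> 0" "norm (1 - circ t) \<noteq> 0" by (auto simp: add_eq_0_iff)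
  then show ?case unfolding norm_one_plus_circ norm_one_minus_circ by simp
qed

text \<open>
  This is the mean value property: \<open>Ln (1 + qz)\<close> is holomorphic on the closed disc and vanishes
  at its centre.
\<close>

lemma has_integral_ln_norm_circ_less:
  fixes q :: complex
  assumes "norm q < 1"
  shows "((\<lambda>t. ln (norm (1 + q * circ t))) has_integral 0) {0..1}"
proof -
  have pos: "Re (1 + q * z) > 0" if "z \<in> cball 0 1" for z
  proof -
    have "norm (q * z) < 1"
      using that assms by (simp add: norm_mult) (meson le_less_trans mult_left_le norm_ge_zero)
    then show ?thesis using abs_Re_le_cmod[of "q * z"] by simp
  qed
  have "(\<lambda>z. Ln (1 + q * z)) holomorphic_on cball 0 1"
  proof (intro holomorphic_intros)
    fix z :: complex assume "z \<in> cball 0 1"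
    from pos[OF this] show "1 + q * z \<notin> \<real>\<^sub>\<le>\<^sub>0" by (auto simp: complex_nonpos_Reals_iff)
  qed
  from Cauchy_integral_circlepath_simple[OF this, of 0]
  have "((\<lambda>u. Ln (1 + q * u) / u) has_contour_integral 0) (circlepath 0 1)" by simp
  then have "((\<lambda>t. Ln (1 + q * circ t) / circ t * (2 * of_real pi * \<i> * circ t)) has_integral 0) {0..1}"
    unfolding has_contour_integral vector_derivative_circlepath
    by (simp add: circlepath circ_def mult_ac)
  then have "((\<lambda>t. 2 * of_real pi * \<i> * Ln (1 + q * circ t)) has_integral 0) {0..1}"
    by (rule has_integral_eq[rotated]) (auto simp: circ_def field_simps)
  from has_integral_mult_right[OF this, of "1 / (2 * of_real pi * \<i>)"]
  have "((\<lambda>t. Ln (1 + q * circ t)) has_integral 0) {0..1}" by (simp add: field_simps)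
  from has_integral_Re[OF this]
  have "((\<lambda>t. Re (Ln (1 + q * circ t))) has_integral 0) {0..1}" by simp
  then show ?thesis
  proof (rule has_integral_eq[rotated])
    fix t :: real
    have "1 + q * circ t \<noteq> 0" using pos[of "circ t"] by (auto simp: complex_eq_iff)
    then show "Re (Ln (1 + q * circ t)) = ln (norm (1 + q * circ t))" by simp
  qed
qed

lemma nn_integral_jensen_less:
  fixes a b :: complex
  assumes "norm b < norm a" and C: "ln (norm a + norm b) \<le> C"
  shows "(\<integral>\<^sup>+t. ennreal (C - ln (norm (a + b * circ t))) \<partial>unif) = ennreal (C - ln (norm a))"
proof -
  have a: "a \<noteq> 0" using assms by auto
  define q where "q = b / a"
  have q: "norm q < 1" using assms a by (simp add: q_def norm_divide)
  have nz: "1 + q * circ t \<noteq> 0" for t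
  proof
    assume "1 + q * circ t = 0"
    then have "norm (q * circ t) = norm (1::complex)" by (metis add_eq_0_iff norm_minus_cancel)
    then show False using q by (simp add: norm_mult)
  qed
  have eq: "norm (a + b * circ t) = norm a * norm (1 + q * circ t)" for t
    using a by (simp add: q_def norm_mult[symmetric] distrib_left)
  have ln_eq: "ln (norm (a + b * circ t)) = ln (norm a) + ln (norm (1 + q * circ t))" for t
    unfolding eq using a nz by (simp add: ln_mult)
  have nn: "0 \<le> C - ln (norm (a + b * circ t))" for t
  proof -
    have "norm (a + b * circ t) \<le> norm a + norm b"
      by (rule order_trans[OF norm_triangle_ineq]) (simp add: norm_mult)
    moreover have "norm (a + b * circ t) > 0" unfolding eq using a nz by simp
    ultimately have "ln (norm (a + b * circ t)) \<le> ln (norm a + norm b)" by (intro ln_mono) auto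
    then show ?thesis using C by simp
  qed
  have "((\<lambda>t. C - ln (norm (a + b * circ t))) has_integral (C - ln (norm a))) {0..1}"
    unfolding ln_eq diff_diff_eq[symmetric]
    using has_integral_diff[OF has_integral_const_real[of "C - ln (norm a)" 0 1] has_integral_ln_norm_circ_less[OF q]]
    by simp
  then show ?thesis
    by (subst nn_integral_unif) (use nn in \<open>auto intro!: nn_integral_has_integral_lebesgue'\<close>)
qed

text \<open>
  For \<open>|b| = |a|\<close> the integrand is unbounded near the zero of \<open>a + bz\<close>, and the case \<open>|b| < |a|\<close> is approached
  through \<open>rb\<close> with \<open>r < 1\<close>. The convergence becomes monotone after a normalization: for
  \<open>|w| = |a|\<close> one has \<open>|a + rw|\<^sup>2 / r = |a|\<^sup>2 (r + 1/r) + 2 Re (a \<cdot> cnj w)\<close>, which decreases as \<open>r\<close> increases to \<open>1\<close>.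
  The summand \<open>ln 3\<close> keeps the normalized functions nonnegative for \<open>1/2 \<le> r < 1\<close>, because \<open>(1 + r)\<^sup>2 \<le> 9r\<close> there.
\<close>

lemma nn_integral_jensen_eq:
  fixes a b :: complex
  assumes ab: "norm b = norm a" "a \<noteq> 0" and C: "ln (norm a) + ln 3 \<le> C"
  shows "(\<integral>\<^sup>+t. ennreal (C - ln (norm (a + b * circ t))) \<partial>unif) = ennreal (C - ln (norm a))"
proof -
  define r where "r n = 1 - 1 / real (n + 2)" for n
  have r: "1 / 2 \<le> r n" "r n < 1" for n by (auto simp: r_def field_simps)
  have r0: "r n > 0" for n using r(1)[of n] by linarith
  have r_mono: "r n \<le> r (Suc n)" for n by (simp add: r_def field_simps)
  have r_lim: "r \<longlonglongrightarrow> 1" unfolding r_def by real_asymp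
  \<comment> \<open>At the zero of \<open>a + bz\<close> the limit would be infinite but \<open>ln 0 = 0\<close>; the value \<open>0\<close> there makes the
    convergence hold everywhere.\<close>
  let ?f = "\<lambda>n t. if a + b * circ t = 0 then 0
    else ennreal (C + ln (r n) / 2 - ln (norm (a + of_real (r n) * b * circ t)))"
  let ?u = "\<lambda>t. if a + b * circ t = 0 then 0 else ennreal (C - ln (norm (a + b * circ t)))"
  have nz: "a + of_real (r n) * b * circ t \<noteq> 0" for n t
  proof
    assume "a + of_real (r n) * b * circ t = 0"
    then have "norm a = norm (of_real (r n) * b * circ t)" by (metis add_eq_0_iff norm_minus_cancel)
    then have "norm a = r n * norm a" using r0[of n] ab by (simp add: norm_mult)
    then show False using ab r(2)[of n] by simp
  qed
  have square_le: "(norm (a + of_real s * w))\<^sup>2 * r \<le> (norm (a + of_real r * w))\<^sup>2 * s"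
    if w: "norm w = norm a" and "0 \<le> r" "r \<le> s" "s \<le> 1" for w r s
  proof -
    have *: "(norm (a + of_real s * w))\<^sup>2 = (1 + s\<^sup>2) * (norm a)\<^sup>2 + 2 * s * Re (a * cnj w)" for s
    proof -
      have "(norm (a + of_real s * w))\<^sup>2 = (norm a)\<^sup>2 + s\<^sup>2 * (norm w)\<^sup>2 + 2 * s * Re (a * cnj w)"
        by (simp add: cmod_power2 power2_sum algebra_simps)
      then show ?thesis by (simp add: w algebra_simps)
    qed
    have "r * s \<le> 1" using that mult_mono[of r 1 s 1] by simp
    then have "0 \<le> (s - r) * (1 - r * s)" using that by simp
    then have "(1 + s\<^sup>2) * r \<le> (1 + r\<^sup>2) * s" by (simp add: algebra_simps power2_eq_square)
    then have "(1 + s\<^sup>2) * r * (norm a)\<^sup>2 \<le> (1 + r\<^sup>2) * s * (norm a)\<^sup>2" by (rule mult_right_mono) simp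
    then show ?thesis unfolding * by (simp add: algebra_simps)
  qed
  have le: "ln r / 2 - ln (norm (a + of_real r * w)) \<le> ln s / 2 - ln (norm (a + of_real s * w))"
    if w: "norm w = norm a" and rs: "0 < r" "r \<le> s" "s \<le> 1" 
      and z: "a + of_real r * w \<noteq> 0" "a + of_real s * w \<noteq> 0" for w r s
  proof -
    have "ln ((norm (a + of_real s * w))\<^sup>2 * r) \<le> ln ((norm (a + of_real r * w))\<^sup>2 * s)"
      using square_le[OF w, of r s] rs z by (intro ln_mono) auto
    then show ?thesis using rs z by (simp add: ln_mult ln_realpow)
  qed
  have "(\<lambda>n. integral\<^sup>N unif (?f n)) \<longlonglongrightarrow> integral\<^sup>N unif ?u"
  proof (rule nn_integral_LIMSEQ)
    show "incseq ?f"
    proof (rule incseq_SucI, rule le_funI)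
      fix n t
      show "?f n t \<le> ?f (Suc n) t"
        using le[of "b * circ t" "r n" "r (Suc n)"] r0[of n] r_mono[of n] r(2)[of "Suc n"] nz[of n t] nz[of "Suc n" t] ab
        by (auto simp: norm_mult mult.assoc intro!: ennreal_leI)
    qed
    show "(\<lambda>n. ?f n t) \<longlonglongrightarrow> ?u t" for t
    proof (cases "a + b * circ t = 0")
      case False
      have "(\<lambda>n. C + ln (r n) / 2 - ln (norm (a + of_real (r n) * b * circ t)))
          \<longlonglongrightarrow> C + ln 1 / 2 - ln (norm (a + of_real 1 * b * circ t))"
        by (intro tendsto_intros r_lim) (use False in auto)
      then show ?thesis using False by (auto intro!: tendsto_ennrealI)
    qed simp
    show "?f n \<in> borel_measurable unif" for n by measurable
  qed
  moreover have "(\<lambda>n. integral\<^sup>N unif (?f n)) \<longlonglongrightarrow> ennreal (C - ln (norm a))"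
  proof -
    have "integral\<^sup>N unif (?f n) = ennreal (C + ln (r n) / 2 - ln (norm a))" for n
    proof -
      have "integral\<^sup>N unif (?f n) = (\<integral>\<^sup>+t. ennreal (C + ln (r n) / 2 - ln (norm (a + of_real (r n) * b * circ t))) \<partial>unif)"
      proof (rule nn_integral_cong_AE)
        have b0: "b \<noteq> 0" using ab by auto
        show "AE t in unif. ?f n t = ennreal (C + ln (r n) / 2 - ln (norm (a + of_real (r n) * b * circ t)))"
          using AE_unif_circ_neq[of "- a / b"]
          by eventually_elim (use b0 in \<open>auto simp: field_simps add_eq_0_iff\<close>)
      qed
      also have "\<dots> = ennreal (C + ln (r n) / 2 - ln (norm a))"
      proof (rule nn_integral_jensen_less)
        show "norm (of_real (r n) * b) < norm a" using ab r0[of n] r(2)[of n] by (simp add: norm_mult)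
        have "(1 + r n)\<^sup>2 \<le> 3\<^sup>2 * r n"
        proof -
          have "r n * r n \<le> 1" using r0[of n] r(2)[of n] by (intro mult_le_one) auto
          then show ?thesis using r(1)[of n] by (simp add: power2_eq_square algebra_simps)
        qed
        then have "ln ((1 + r n)\<^sup>2) \<le> ln (3\<^sup>2 * r n)" using r0[of n] by (intro ln_mono) auto
        moreover have "ln ((1 + r n)\<^sup>2) = 2 * ln (1 + r n)" "ln (3\<^sup>2 * r n) = 2 * ln 3 + ln (r n)"
          using r0[of n] by (simp_all only: ln_mult ln_realpow) (auto simp: ln_realpow[of 3 2, simplified])
        ultimately have "ln (1 + r n) \<le> ln 3 + ln (r n) / 2" by linarith
        moreover have "norm a + norm (of_real (r n) * b) = norm a * (1 + r n)"
          using ab r0[of n] by (simp add: norm_mult algebra_simps)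
        ultimately show "ln (norm a + norm (of_real (r n) * b)) \<le> C + ln (r n) / 2"
          using C ab r0[of n] by (simp add: ln_mult)
      qed
      finally show ?thesis .
    qed
    moreover have "(\<lambda>n. C + ln (r n) / 2 - ln (norm a)) \<longlonglongrightarrow> C + ln 1 / 2 - ln (norm a)"
      by (intro tendsto_intros r_lim) auto
    ultimately show ?thesis by (auto intro!: tendsto_ennrealI)
  qed
  ultimately have "integral\<^sup>N unif ?u = ennreal (C - ln (norm a))" by (rule LIMSEQ_unique)
  moreover have "integral\<^sup>N unif ?u = (\<integral>\<^sup>+t. ennreal (C - ln (norm (a + b * circ t))) \<partial>unif)"
  proof (rule nn_integral_cong_AE)
    have b0: "b \<noteq> 0" using ab by auto
    show "AE t in unif. ?u t = ennreal (C - ln (norm (a + b * circ t)))"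
      using AE_unif_circ_neq[of "- a / b"]
      by eventually_elim (use b0 in \<open>auto simp: field_simps add_eq_0_iff\<close>)
  qed
  ultimately show ?thesis by simp
qed

text \<open>
  For \<open>|b| > |a|\<close> the roles of \<open>a\<close> and \<open>b\<close> are exchanged by conjugating and multiplying with the
  point of the circle, which does not affect the modulus.
\<close>

lemma has_bochner_integral_jensen:
  fixes a b :: complex
  assumes "a \<noteq> 0" "b \<noteq> 0"
  shows "has_bochner_integral unif (\<lambda>t. ln (norm (a + b * circ t))) (max (ln (norm a)) (ln (norm b)))"
proof -
  have *: "has_bochner_integral unif (\<lambda>t. ln (norm (a + b * circ t))) (ln (norm a))"
    if ab: "a \<noteq> 0" "norm b \<le> norm a" for a b :: complex
  proof -
    define C where "C = ln (norm a) + ln 3"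
    have sum_le: "norm a + norm b \<le> norm a * 3" using ab norm_ge_zero[of a] by linarith
    have C_ge: "ln (norm a + norm b) \<le> C"
    proof -
      have "ln (norm a + norm b) \<le> ln (norm a * 3)"
        using ab sum_le by (intro ln_mono) (auto intro: add_pos_nonneg)
      then show ?thesis using ab by (simp add: C_def ln_mult)
    qed
    have int: "(\<integral>\<^sup>+t. ennreal (C - ln (norm (a + b * circ t))) \<partial>unif) = ennreal (C - ln (norm a))"
    proof (cases "norm b = norm a")
      case True then show ?thesis using ab by (intro nn_integral_jensen_eq) (auto simp: C_def)
    next
      case False then show ?thesis using ab C_ge by (intro nn_integral_jensen_less) auto
    qed
    have le: "ln (norm (a + b * circ t)) \<le> C" if "a + b * circ t \<noteq> 0" for t
    proof -
      have "norm (a + b * circ t) \<le> norm a + norm b"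
        by (rule order_trans[OF norm_triangle_ineq]) (simp add: norm_mult)
      then have "ln (norm (a + b * circ t)) \<le> ln (norm a + norm b)" using that by (intro ln_mono) auto
      then show ?thesis using C_ge by simp
    qed
    have "AE t in unif. 0 \<le> C - ln (norm (a + b * circ t))"
    proof (cases "b = 0")
      case True then show ?thesis using le ab by simp
    next
      case False
      show ?thesis
        using AE_unif_circ_neq[of "- a / b"]
        by eventually_elim (use le False in \<open>auto simp: field_simps add_eq_0_iff\<close>)
    qed
    then have "has_bochner_integral unif (\<lambda>t. C - ln (norm (a + b * circ t))) (C - ln (norm a))"
      by (intro has_bochner_integral_nn_integral int) (auto simp: C_def)
    moreover have "has_bochner_integral unif (\<lambda>t. C) C"
      using unif.prob_space by (simp add: has_bochner_integral_iff)
    ultimately have "has_bochner_integral unif (\<lambda>t. C - (C - ln (norm (a + b * circ t)))) (C - (C - ln (norm a)))"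
      by (rule has_bochner_integral_diff[rotated])
    then show ?thesis by simp
  qed
  show ?thesis
  proof (cases "norm b \<le> norm a")
    case True
    then have "ln (norm b) \<le> ln (norm a)" using assms by (intro ln_mono) auto
    then show ?thesis using *[of a b] assms True by (simp add: max_absorb1)
  next
    case False
    have swap: "norm (a + b * circ t) = norm (cnj b + cnj a * circ t)" for t
    proof -
      have "cnj (circ t) * circ t = 1"
        using complex_norm_square[of "circ t"] by (simp add: mult.commute)
      then have "cnj (a + b * circ t) * circ t = cnj b + cnj a * circ t"
        by (simp add: distrib_right mult.assoc)
      then show ?thesis by (metis complex_mod_cnj mult.right_neutral norm_circ norm_mult)
    qed
    have "ln (norm a) \<le> ln (norm b)" using assms False by (intro ln_mono) auto
    then show ?thesis
      unfolding swap using *[of "cnj b" "cnj a"] assms False by (simp add: max_absorb2)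
  qed
qed

lemma nn_integral_jensen:
  assumes "a \<noteq> 0" "b \<noteq> 0" and C: "norm a + norm b \<le> exp C" "0 \<le> C"
  shows "(\<integral>\<^sup>+t. ennreal (C - ln (norm (a + b * circ t))) \<partial>unif) = ennreal (C - max (ln (norm a)) (ln (norm b)))"
proof -
  have "has_bochner_integral unif (\<lambda>t. C) C"
    using unif.prob_space by (simp add: has_bochner_integral_iff)
  then have "has_bochner_integral unif (\<lambda>t. C - ln (norm (a + b * circ t))) (C - max (ln (norm a)) (ln (norm b)))"
    by (rule has_bochner_integral_diff[OF _ has_bochner_integral_jensen[OF assms(1,2)]])
  moreover have "0 \<le> C - ln (norm (a + b * circ t))" for t
  proof (cases "a + b * circ t = 0")
    case False
    have "norm (a + b * circ t) \<le> norm a + norm b"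
      by (rule order_trans[OF norm_triangle_ineq]) (simp add: norm_mult)
    then have "ln (norm (a + b * circ t)) \<le> ln (exp C)" using False C by (intro ln_mono) auto
    then show ?thesis by simp
  qed (use C in simp)
  ultimately show ?thesis
    by (subst nn_integral_eq_integral) (auto simp: has_bochner_integral_iff)
qed

text \<open>
  These are Jensen's formula for \<open>1 + z\<close> and \<open>1 - z\<close>, whose moduli are \<open>2 |cos (\<pi>t)|\<close> and \<open>2 |sin (\<pi>t)|\<close>.
\<close>

lemma has_bochner_integral_ln_cos:
  "has_bochner_integral unif (\<lambda>t. ln \<bar>cos (pi * t)\<bar>) (- ln 2)"
  and has_bochner_integral_ln_sin:
  "has_bochner_integral unif (\<lambda>t. ln \<bar>sin (pi * t)\<bar>) (- ln 2)"
proof -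
  have const: "has_bochner_integral unif (\<lambda>t. ln 2) (ln 2 :: real)"
    using unif.prob_space by (simp add: has_bochner_integral_iff)
  have *: "has_bochner_integral unif f (- ln 2)"
    if J: "has_bochner_integral unif g 0" and eq: "AE t in unif. g t - ln 2 = f t"
      and [measurable]: "f \<in> borel_measurable borel" for f g :: "real \<Rightarrow> real"
  proof -
    have "has_bochner_integral unif (\<lambda>t. g t - ln 2) (0 - ln 2)"
      by (rule has_bochner_integral_diff[OF J const])
    moreover have "has_bochner_integral unif (\<lambda>t. g t - ln 2) (0 - ln 2) \<longleftrightarrow> has_bochner_integral unif f (0 - ln 2)"
    proof (rule has_bochner_integral_cong_AE)
      show "(\<lambda>t. g t - ln 2) \<in> borel_measurable unif"
        using J by (auto simp: has_bochner_integral_iff)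
    qed (use eq in auto)
    ultimately show ?thesis by simp
  qed
  show "has_bochner_integral unif (\<lambda>t. ln \<bar>cos (pi * t)\<bar>) (- ln 2)"
  proof (rule *)
    show "has_bochner_integral unif (\<lambda>t. ln (norm (1 + 1 * circ t))) 0"
      using has_bochner_integral_jensen[of 1 1] by simp
    show "AE t in unif. ln (norm (1 + 1 * circ t)) - ln 2 = ln \<bar>cos (pi * t)\<bar>"
      using AE_unif_cos_sin_neq by eventually_elim (simp add: norm_one_plus_circ ln_mult)
  qed measurable
  show "has_bochner_integral unif (\<lambda>t. ln \<bar>sin (pi * t)\<bar>) (- ln 2)"
  proof (rule *)
    show "has_bochner_integral unif (\<lambda>t. ln (norm (1 + (- 1) * circ t))) 0"
      using has_bochner_integral_jensen[of 1 "-1"] by simp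
    show "AE t in unif. ln (norm (1 + (- 1) * circ t)) - ln 2 = ln \<bar>sin (pi * t)\<bar>"
      using AE_unif_cos_sin_neq by eventually_elim (simp add: norm_one_minus_circ ln_mult)
  qed measurable
qed

section \<open>The law of the logarithm of a cotangent\<close>

lemma measurable_cosh [measurable]: "(cosh :: real \<Rightarrow> real) \<in> borel_measurable borel"
  by (intro borel_measurable_continuous_onI continuous_intros)

lemma DERIV_arctan_exp:
  "((\<lambda>x. arctan (exp x)) has_real_derivative 1 / (2 * cosh x)) (at x)"
proof -
  have *: "E / (1 + E\<^sup>2) = 1 / (E + inverse E)" if "E > 0" for E :: real
  proof -
    have "1 + E\<^sup>2 > 0" "E + inverse E > 0" using that by (auto intro!: add_pos_pos)
    moreover have "E * (E + inverse E) = 1 + E\<^sup>2"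
      using that by (simp add: power2_eq_square distrib_left)
    ultimately show ?thesis by (simp add: frac_eq_eq)
  qed
  have c: "2 * cosh x = exp x + inverse (exp x)"
    by (simp add: cosh_def exp_minus)
  show ?thesis
    unfolding c *[OF exp_gt_zero, symmetric]
    by (rule DERIV_cong[OF DERIV_chain2[OF DERIV_arctan DERIV_exp]])
      (simp only: divide_inverse mult.commute)
qed

text \<open>
  The cotangent of a uniform angle is a Cauchy variable; the logarithm of its absolute value
  has the hyperbolic secant density. Under the substitution \<open>\<pi>s = arctan (exp x)\<close> this logarithm is \<open>-x\<close>, and
  the density is even.
\<close>

lemma nn_integral_log_cot:
  fixes F :: "real \<Rightarrow> ennreal"
  assumes [measurable]: "F \<in> borel_measurable borel"
  shows "(\<integral>\<^sup>+s. F (ln \<bar>cos (pi * s)\<bar> - ln \<bar>sin (pi * s)\<bar>) \<partial>unif) =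
    (\<integral>\<^sup>+x. F x * ennreal (1 / (pi * cosh x)) \<partial>lborel)"
proof -
  let ?f = "\<lambda>s. F (ln \<bar>cos (pi * s)\<bar> - ln \<bar>sin (pi * s)\<bar>)"
  let ?h = "\<lambda>x. F (ln \<bar>cos x\<bar> - ln \<bar>sin x\<bar>)"
  have sym: "?f (1 - t) = ?f t" for t
    by (simp add: right_diff_distrib cos_diff sin_diff)
  have lims: "((\<lambda>x. arctan (exp x)) \<longlongrightarrow> 0) at_bot" "((\<lambda>x. arctan (exp x)) \<longlongrightarrow> pi / 2) at_top"
  proof -
    show "((\<lambda>x. arctan (exp x)) \<longlongrightarrow> 0) at_bot"
      using tendsto_arctan[OF exp_at_bot] by simp
    show "((\<lambda>x. arctan (exp x)) \<longlongrightarrow> pi / 2) at_top"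
      by (rule filterlim_compose[OF tendsto_arctan_at_top exp_at_top])
  qed
  have "(\<integral>\<^sup>+s. ?f s \<partial>unif) = ennreal (2 / pi) * (\<integral>\<^sup>+x. ?h x * indicator {0<..<pi/2} x \<partial>lborel)"
    by (subst nn_integral_unif_fold) (use sym in auto)
  also have "(\<integral>\<^sup>+x. ?h x * indicator {0<..<pi/2} x \<partial>lborel) =
      (\<integral>\<^sup>+x. ?h (arctan (exp x)) * ennreal (1 / (2 * cosh x)) \<partial>lborel)"
  proof (rule nn_integral_substitution_line)
    show "((\<lambda>x. arctan (exp x)) has_real_derivative 1 / (2 * cosh x)) (at x)" for x
      by (rule DERIV_arctan_exp)
  qed (use lims in \<open>auto intro!: continuous_intros simp: add_pos_pos\<close>)
  also have "\<dots> = (\<integral>\<^sup>+x. F (- x) * ennreal (1 / (2 * cosh x)) \<partial>lborel)"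
  proof (rule nn_integral_cong)
    fix x :: real
    have "cos (arctan (exp x)) > 0" "sin (arctan (exp x)) > 0" 
      using cos_gt_zero_pi[of "arctan (exp x)"] arctan_ubound[of "exp x"] arctan_lbound[of "exp x"] 
      by (auto intro!: sin_gt_zero simp: field_simps)
    then have "ln \<bar>cos (arctan (exp x))\<bar> - ln \<bar>sin (arctan (exp x))\<bar> = - ln (tan (arctan (exp x)))"
      by (simp add: ln_div tan_def)
    then show "?h (arctan (exp x)) * ennreal (1 / (2 * cosh x)) = F (- x) * ennreal (1 / (2 * cosh x))"
      by (simp add: tan_arctan)
  qed
  also have "\<dots> = (\<integral>\<^sup>+x. F x * ennreal (1 / (2 * cosh x)) \<partial>lborel)"
    by (subst nn_integral_real_affine[where c = "-1" and t = 0]) auto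
  also have "ennreal (2 / pi) * \<dots> = (\<integral>\<^sup>+x. F x * ennreal (1 / (pi * cosh x)) \<partial>lborel)"
  proof (subst nn_integral_cmult[symmetric])
    show "(\<integral>\<^sup>+x. ennreal (2 / pi) * (F x * ennreal (1 / (2 * cosh x))) \<partial>lborel) =
        (\<integral>\<^sup>+x. F x * ennreal (1 / (pi * cosh x)) \<partial>lborel)"
      by (intro nn_integral_cong, subst mult.left_commute, subst ennreal_mult'[symmetric]) simp_all
  qed simp
  finally show ?thesis .
qed

section \<open>The law of the logarithm of a cotangent times a ratio of cosines\<close>

text \<open>
  In the variable \<open>sin x\<close> this is the elementary integral of \<open>1 / (K\<^sup>2 - s\<^sup>2)\<close>.
\<close>

lemma nn_integral_cos_over_square:
  fixes K :: real
  assumes K: "K > 1"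
  shows "(\<integral>\<^sup>+x. ennreal (cos x / (K\<^sup>2 - (sin x)\<^sup>2)) * indicator {0<..<pi/2} x \<partial>lborel) =
    ennreal ((ln (K + 1) - ln (K - 1)) / (2 * K))"
proof -
  define F where "F x = (ln (K + sin x) - ln (K - sin x)) / (2 * K)" for x
  have pos: "K + sin x > 0" "K - sin x > 0" for x
    using K sin_le_one[of x] sin_ge_minus_one[of x] by linarith+
  have fac: "K\<^sup>2 - (sin x)\<^sup>2 = (K + sin x) * (K - sin x)" for x
    by (simp add: power2_eq_square algebra_simps)
  have "(\<integral>\<^sup>+x. ennreal (cos x / (K\<^sup>2 - (sin x)\<^sup>2)) * indicator {0..pi/2} x \<partial>lborel) = ennreal (F (pi / 2) - F 0)"
  proof (rule nn_integral_FTC_Icc)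
    fix x :: real assume x: "x \<in> {0..pi/2}"
    have alg: "(cos x / p - - cos x / m) / (2 * K) = cos x / (p * m)" if "p > 0" "m > 0" "p + m = 2 * K" for p m
    proof -
      have eq: "cos x / p - - cos x / m = cos x * (p + m) / (p * m)" using that(1,2) by (simp add: field_simps)
      show ?thesis unfolding eq that(3) using K by simp
    qed
    have "(F has_real_derivative (cos x / (K + sin x) - - cos x / (K - sin x)) / (2 * K)) (at x)"
      unfolding F_def using pos[of x] by (intro DERIV_cdivide) (auto intro!: derivative_eq_intros)
    then show "(F has_real_derivative cos x / (K\<^sup>2 - (sin x)\<^sup>2)) (at x)"
      unfolding fac by (subst (asm) alg) (use pos[of x] in auto)
    show "0 \<le> cos x / (K\<^sup>2 - (sin x)\<^sup>2)"
      unfolding fac using pos[of x] x by (intro divide_nonneg_pos cos_ge_zero) auto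
  qed auto
  then show ?thesis by (simp add: nn_integral_Ioo_eq_Icc F_def)
qed

lemma measurable_tan [measurable]: "(tan :: real \<Rightarrow> real) \<in> borel_measurable borel"
  unfolding tan_def[abs_def] by measurable

text \<open>
  The square root \<open>K\<close> disappears under the substitution \<open>r sin \<phi> = b sin x\<close>, which gives \<open>r cos \<phi> = K x\<close>
  and \<open>d\<phi> = b cos x / K x dx\<close>; the angle \<open>\<phi>\<close> ends at \<open>arcsin (b / r) = arctan b\<close>.
\<close>

lemma nn_integral_ln_cos_ratio_substitution:
  fixes b :: real
  assumes b: "b > 0"
  defines "K \<equiv> \<lambda>x. sqrt (1 + b\<^sup>2 * (cos x)\<^sup>2)" and "r \<equiv> sqrt (1 + b\<^sup>2)"
  shows "(\<integral>\<^sup>+x. ennreal (ln (K x + 1) - ln (K x - 1)) * ennreal (b * cos x / K x) * indicator {0<..<pi/2} x \<partial>lborel) =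
    (\<integral>\<^sup>+x. ennreal (ln (r * cos x + 1) - ln (r * cos x - 1)) * indicator {0<..<arctan b} x \<partial>lborel)"
proof -
  define g where "g x = arcsin (b / r * sin x)" for x
  have r: "r > 0" "r\<^sup>2 = 1 + b\<^sup>2" by (auto simp: r_def add_pos_nonneg)
  have br: "0 < b / r" "b / r < 1"
    using b r by (auto simp: r_def intro: real_less_rsqrt)
  have K: "K x > 0" "(K x)\<^sup>2 = 1 + b\<^sup>2 * (cos x)\<^sup>2" for x
    by (auto simp: K_def add_pos_nonneg)
  have abs_lt: "\<bar>b / r * sin x\<bar> < 1" for x
  proof -
    have "\<bar>b / r * sin x\<bar> \<le> b / r * 1"
      unfolding abs_mult using br by (intro mult_mono) auto
    then show ?thesis using br by linarith
  qed
  have lt: "b / r * sin x < 1" "-1 < b / r * sin x" for x using abs_lt[of x] by linarith+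
  have K_eq: "sqrt (1 - (b / r * sin x)\<^sup>2) = K x / r" for x
  proof (rule real_sqrt_unique)
    have e: "(K x)\<^sup>2 = r\<^sup>2 - b\<^sup>2 * (sin x)\<^sup>2" unfolding K r by (simp add: sin_squared_eq algebra_simps)
    show "(K x / r)\<^sup>2 = 1 - (b / r * sin x)\<^sup>2"
      unfolding power_mult_distrib power_divide e using r(1) by (simp add: diff_divide_distrib)
  qed (use r K[of x] in auto)
  have "arctan b = arcsin (b / r)"
    unfolding r_def using arcsin_sin[of "arctan b"] arctan_bounded[of b] by (simp add: sin_arctan)
  then have g_ends: "g 0 = 0" "g (pi / 2) = arctan b" by (auto simp: g_def)
  have cos_g: "r * cos (g x) = K x" for x
  proof -
    have "cos (g x) = K x / r"
      unfolding g_def K_eq[symmetric] by (rule cos_arcsin) (use lt[of x] in linarith)+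
    then show ?thesis using r by simp
  qed
  have "(\<integral>\<^sup>+x. ennreal (ln (r * cos x + 1) - ln (r * cos x - 1)) * indicator {g 0..g (pi/2)} x \<partial>lborel) =
    (\<integral>\<^sup>+x. ennreal (ln (r * cos (g x) + 1) - ln (r * cos (g x) - 1)) * ennreal (b * cos x / K x) * indicator {0..pi/2} x \<partial>lborel)"
  proof (rule nn_integral_substitution_aux)
    fix x :: real assume x: "x \<in> {0..pi/2}"
    have "(g has_real_derivative inverse (sqrt (1 - (b / r * sin x)\<^sup>2)) * (b / r * cos x)) (at x)"
      unfolding g_def by (rule DERIV_chain2[OF DERIV_arcsin]) (use lt r in \<open>auto intro!: derivative_eq_intros\<close>)
    also have "inverse (sqrt (1 - (b / r * sin x)\<^sup>2)) * (b / r * cos x) = b * cos x / K x"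
      unfolding K_eq using r K(1)[of x] by (simp add: field_simps)
    finally show "(g has_real_derivative b * cos x / K x) (at x)" .
    show "0 \<le> b * cos x / K x" using b x K(1)[of x] by (intro divide_nonneg_pos mult_nonneg_nonneg cos_ge_zero) auto
  next
    show "continuous_on {0..pi/2} (\<lambda>x. b * cos x / K x)"
    proof (rule continuous_on_divide)
      show "\<forall>x\<in>{0..pi/2}. K x \<noteq> 0" using K(1) by (metis less_irrefl)
    qed (auto simp: K_def intro!: continuous_intros)
  qed auto
  then show ?thesis unfolding g_ends cos_g by (simp add: nn_integral_Ioo_eq_Icc)
qed

text \<open>
  With \<open>p = arctan b\<close> one has \<open>r cos p = 1\<close>, so the quotient of the two arguments of the logarithm is
  \<open>(cos x + cos p) / (cos x - cos p) = cot ((p - x)/2) cot ((p + x)/2)\<close>. As \<open>x\<close> runs from \<open>0\<close> to \<open>p\<close>, the two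
  half angles together run exactly once, at half the speed, through the interval from \<open>0\<close> to \<open>p\<close>. The bound \<open>b \<le> 1\<close>
  keeps both logarithms of cotangents nonnegative.
\<close>

lemma nn_integral_ln_cos_ratio:
  fixes b :: real
  assumes b: "0 < b" "b \<le> 1"
  defines "r \<equiv> sqrt (1 + b\<^sup>2)"
  shows "(\<integral>\<^sup>+x. ennreal (ln (r * cos x + 1) - ln (r * cos x - 1)) * indicator {0<..<arctan b} x \<partial>lborel) =
    2 * (\<integral>\<^sup>+x. ennreal (- ln (tan x)) * indicator {0<..<arctan b} x \<partial>lborel)"
proof -
  define p where "p = arctan b"
  have p: "0 < p" "p \<le> pi / 4"
    using b arctan_monotone'[of b 1] by (auto simp: p_def arctan_one)
  have r: "r > 0" by (auto simp: r_def add_pos_nonneg)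
  have cos_p: "r * cos p = 1" using r by (simp add: p_def r_def cos_arctan)
  have tan_le: "0 < tan x" "tan x \<le> 1" if "0 < x" "x \<le> pi / 4" for x
  proof -
    show "0 < tan x" using that pi_gt_zero by (intro tan_gt_zero) linarith+
    have "tan x \<le> tan (pi / 4)" 
      using that pi_gt_zero by (intro tan_mono_le) linarith+
    then show "tan x \<le> 1" by (simp add: tan_45)
  qed
  have split: "ln (r * cos x + 1) - ln (r * cos x - 1) = - ln (tan ((p - x) / 2)) + - ln (tan ((p + x) / 2))"
    if x: "0 < x" "x < p" for x
  proof -
    have pi4: "p + x < pi" "p - x < pi" using x p pi_gt_zero by simp_all
    have m: "0 < (p - x) / 2" "(p - x) / 2 < pi / 2" "0 < (p + x) / 2" "(p + x) / 2 < pi / 2"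
      using x pi4 by simp_all
    have pos: "0 < sin ((p - x) / 2)" "0 < cos ((p - x) / 2)" "0 < sin ((p + x) / 2)" "0 < cos ((p + x) / 2)"
      using m pi_gt_zero by (auto intro!: sin_gt_zero cos_gt_zero)
    have c1: "cos x + cos p = 2 * cos ((p + x) / 2) * cos ((p - x) / 2)"
      using cos_plus_cos[of p x] by (simp add: add.commute)
    have c2: "cos x - cos p = 2 * sin ((p + x) / 2) * sin ((p - x) / 2)"
      using cos_diff_cos[of x p] by (simp add: add.commute)
    have "ln (r * cos x + 1) = ln (r * (2 * cos ((p + x) / 2) * cos ((p - x) / 2)))"
      unfolding c1[symmetric] by (simp add: distrib_left cos_p)
    moreover have "ln (r * cos x - 1) = ln (r * (2 * sin ((p + x) / 2) * sin ((p - x) / 2)))"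
      unfolding c2[symmetric] by (simp add: right_diff_distrib cos_p)
    ultimately show ?thesis
      using pos r by (simp add: ln_mult ln_div tan_def)
  qed
  let ?h = "\<lambda>x. ennreal (- ln (tan x))"
  have "(\<integral>\<^sup>+x. ennreal (ln (r * cos x + 1) - ln (r * cos x - 1)) * indicator {0<..<p} x \<partial>lborel) =
      (\<integral>\<^sup>+x. ?h ((p - x) / 2) * indicator {0<..<p} x + ?h ((p + x) / 2) * indicator {0<..<p} x \<partial>lborel)"
  proof (rule nn_integral_cong)
    fix x :: real
    show "ennreal (ln (r * cos x + 1) - ln (r * cos x - 1)) * indicator {0<..<p} x =
        ?h ((p - x) / 2) * indicator {0<..<p} x + ?h ((p + x) / 2) * indicator {0<..<p} x"
    proof (cases "x \<in> {0<..<p}")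
      case True
      then have "tan ((p - x) / 2) \<in> {0<..1}" "tan ((p + x) / 2) \<in> {0<..1}"
        using p tan_le[of "(p - x) / 2"] tan_le[of "(p + x) / 2"] by auto
      then have nn: "0 \<le> - ln (tan ((p - x) / 2))" "0 \<le> - ln (tan ((p + x) / 2))" by auto
      have "ln (r * cos x + 1) - ln (r * cos x - 1) = - ln (tan ((p - x) / 2)) + - ln (tan ((p + x) / 2))"
        using True by (intro split) auto
      then show ?thesis using True by (simp only: ennreal_plus[OF nn] indicator_simps mult_1_right)
    qed simp
  qed
  also have "\<dots> = (\<integral>\<^sup>+x. ?h ((p - x) / 2) * indicator {0<..<p} x \<partial>lborel) + (\<integral>\<^sup>+x. ?h ((p + x) / 2) * indicator {0<..<p} x \<partial>lborel)"
    by (rule nn_integral_add) measurable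
  also have "(\<integral>\<^sup>+x. ?h ((p - x) / 2) * indicator {0<..<p} x \<partial>lborel) = 2 * (\<integral>\<^sup>+x. ?h x * indicator {0<..<p/2} x \<partial>lborel)"
    by (subst nn_integral_real_affine[where c = "-2" and t = p])
      (auto simp: indicator_def intro!: arg_cong[where f = "\<lambda>x. 2 * x"] nn_integral_cong)
  also have "(\<integral>\<^sup>+x. ?h ((p + x) / 2) * indicator {0<..<p} x \<partial>lborel) = 2 * (\<integral>\<^sup>+x. ?h x * indicator {p/2<..<p} x \<partial>lborel)"
    by (subst nn_integral_real_affine[where c = "2" and t = "- p"])
      (auto simp: indicator_def intro!: arg_cong[where f = "\<lambda>x. 2 * x"] nn_integral_cong)
  also have "2 * (\<integral>\<^sup>+x. ?h x * indicator {0<..<p/2} x \<partial>lborel) + 2 * (\<integral>\<^sup>+x. ?h x * indicator {p/2<..<p} x \<partial>lborel) =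
     2 * (\<integral>\<^sup>+x. ?h x * indicator {0<..<p/2} x + ?h x * indicator {p/2<..<p} x \<partial>lborel)"
    by (subst nn_integral_add) (auto simp: distrib_left)
  also have "(\<integral>\<^sup>+x. ?h x * indicator {0<..<p/2} x + ?h x * indicator {p/2<..<p} x \<partial>lborel) =
     (\<integral>\<^sup>+x. ?h x * indicator {0<..<p} x \<partial>lborel)"
    by (rule nn_integral_cong_AE, rule AE_mp[OF AE_lborel_neq[of "p/2"]]) (use p in \<open>auto simp: indicator_def\<close>)
  finally show ?thesis unfolding p_def .
qed

lemma nn_integral_ln_tan:
  "(\<integral>\<^sup>+x. ennreal (- ln (tan x)) * indicator {0<..<arctan (exp y)} x \<partial>lborel) =
    (\<integral>\<^sup>+u. ennreal (u / (2 * cosh u)) * indicator {- y<..} u \<partial>lborel)"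
proof -
  let ?f = "\<lambda>x. ennreal (- ln (tan x)) * indicator {0<..<arctan (exp y)} x"
  have "(\<integral>\<^sup>+x. ?f x \<partial>lborel) = (\<integral>\<^sup>+x. ?f x * indicator {0<..<pi/2} x \<partial>lborel)"
    using arctan_ubound[of "exp y"] by (intro nn_integral_cong) (auto simp: indicator_def)
  also have "\<dots> = (\<integral>\<^sup>+u. ?f (arctan (exp u)) * ennreal (1 / (2 * cosh u)) \<partial>lborel)"
  proof (rule nn_integral_substitution_line)
    show "((\<lambda>x. arctan (exp x)) \<longlongrightarrow> 0) at_bot"
      using tendsto_arctan[OF exp_at_bot] by simp
    show "((\<lambda>x. arctan (exp x)) \<longlongrightarrow> pi / 2) at_top"
      by (rule filterlim_compose[OF tendsto_arctan_at_top exp_at_top])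
  qed (auto intro!: DERIV_arctan_exp continuous_intros)
  also have "\<dots> = (\<integral>\<^sup>+u. ?f (arctan (exp (- u))) * ennreal (1 / (2 * cosh u)) \<partial>lborel)"
    by (subst nn_integral_real_affine[where c = "-1" and t = 0]) auto
  also have "\<dots> = (\<integral>\<^sup>+u. ennreal (u / (2 * cosh u)) * indicator {- y<..} u \<partial>lborel)"
  proof (rule nn_integral_cong)
    fix u :: real
    have "arctan (exp (- u)) \<in> {0<..<arctan (exp y)} \<longleftrightarrow> - y < u"
      by (auto simp: arctan_less_iff)
    then show "?f (arctan (exp (- u))) * ennreal (1 / (2 * cosh u)) = ennreal (u / (2 * cosh u)) * indicator {- y<..} u"
      by (auto simp: indicator_def tan_arctan ennreal_mult''[symmetric])
  qed
  finally show ?thesis .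
qed

text \<open>
  For \<open>R = ln |cos (\<pi>x)| - ln |cos (\<pi>z)|\<close> the left-hand side is the density at \<open>y\<close> of the sum of \<open>R\<close> and an
  independent variable with the hyperbolic secant density. Written in the cosines, the integrand is
  rational; the integral over \<open>x\<close> is elementary, and the one over \<open>z\<close> is reduced by the
  preceding lemmas to the integral of \<open>- ln (tan \<psi>)\<close> from \<open>0\<close> to \<open>arctan (exp y)\<close>. Its upper limit is the
  only place where \<open>y\<close> is left, which explains why the derivative of the density is so simple.
\<close>

lemma nn_integral_sech_shift_nonpos:
  fixes y :: real
  assumes y: "y \<le> 0"
  shows "(\<integral>\<^sup>+z. \<integral>\<^sup>+x. ennreal (1 / (pi * cosh (y - (ln \<bar>cos (pi * x)\<bar> - ln \<bar>cos (pi * z)\<bar>)))) \<partial>unif \<partial>unif) =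
    (\<integral>\<^sup>+u. ennreal (4 / pi ^ 3 * (u / cosh u)) * indicator {\<bar>y\<bar><..} u \<partial>lborel)"
proof -
  define b where "b = exp y"
  have b: "0 < b" "b \<le> 1" using y by (auto simp: b_def)
  define r where "r = sqrt (1 + b\<^sup>2)"
  define K where "K x = sqrt (1 + b\<^sup>2 * (cos x)\<^sup>2)" for x
  have cosh_eq: "1 / (pi * cosh (y - (ln p - ln q))) = 2 * b * q / pi * (p / (b\<^sup>2 * q\<^sup>2 + p\<^sup>2))"
    if "p > 0" "q > 0" for p q
  proof -
    have e: "exp (y - (ln p - ln q)) = b * q / p"
      using that by (simp add: b_def exp_diff exp_add)
    have "cosh (y - (ln p - ln q)) = (b * q / p + p / (b * q)) / 2"
      unfolding cosh_def exp_minus e by simp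
    also have "\<dots> = (b\<^sup>2 * q\<^sup>2 + p\<^sup>2) / (2 * b * q * p)"
      using that b(1) by (simp add: add_frac_eq power2_eq_square mult_ac)
    finally show ?thesis by (simp add: mult_ac)
  qed
  \<comment> \<open>\<open>b\<^sup>2 cos\<^sup>2 z + cos\<^sup>2 x = K\<^sup>2 - sin\<^sup>2 x\<close>, and \<open>K > 1\<close> makes the integral over \<open>x\<close> nonsingular\<close>
  have inner: "(\<integral>\<^sup>+x. ennreal (1 / (pi * cosh (y - (ln \<bar>cos (pi * x)\<bar> - ln (cos z))))) \<partial>unif) =
      ennreal (2 / pi\<^sup>2) * (ennreal (ln (K z + 1) - ln (K z - 1)) * ennreal (b * cos z / K z))"
    if z: "z \<in> {0<..<pi/2}" for z
  proof -
    have cz: "cos z > 0" using z by (auto intro: cos_gt_zero)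
    have "K z > 1" using cz b by (auto simp: K_def intro!: real_less_rsqrt add_pos_pos)
    have "(\<integral>\<^sup>+x. ennreal (1 / (pi * cosh (y - (ln \<bar>cos (pi * x)\<bar> - ln (cos z))))) \<partial>unif) =
        ennreal (2 / pi) * (\<integral>\<^sup>+x. ennreal (1 / (pi * cosh (y - (ln (cos x) - ln (cos z))))) * indicator {0<..<pi/2} x \<partial>lborel)"
      by (rule nn_integral_unif_abs_cos) measurable
    also have "(\<integral>\<^sup>+x. ennreal (1 / (pi * cosh (y - (ln (cos x) - ln (cos z))))) * indicator {0<..<pi/2} x \<partial>lborel) =
        (\<integral>\<^sup>+x. ennreal (2 * b * cos z / pi) * (ennreal (cos x / ((K z)\<^sup>2 - (sin x)\<^sup>2)) * indicator {0<..<pi/2} x) \<partial>lborel)"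
    proof (rule nn_integral_cong)
      fix x :: real
      show "ennreal (1 / (pi * cosh (y - (ln (cos x) - ln (cos z))))) * indicator {0<..<pi/2} x =
          ennreal (2 * b * cos z / pi) * (ennreal (cos x / ((K z)\<^sup>2 - (sin x)\<^sup>2)) * indicator {0<..<pi/2} x)"
      proof (cases "x \<in> {0<..<pi/2}")
        case True
        then have cx: "cos x > 0" by (auto intro: cos_gt_zero)
        have "(K z)\<^sup>2 - (sin x)\<^sup>2 = b\<^sup>2 * (cos z)\<^sup>2 + (cos x)\<^sup>2"
          by (simp add: K_def add_nonneg_nonneg sin_squared_eq)
        then show ?thesis
          using True cx cz b by (simp only: cosh_eq[OF cx cz]) (simp add: ennreal_mult'[symmetric])
      qed simp
    qed
    also have "\<dots> = ennreal (2 * b * cos z / pi) * ennreal ((ln (K z + 1) - ln (K z - 1)) / (2 * K z))"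
      by (subst nn_integral_cmult) (simp_all add: nn_integral_cos_over_square[OF \<open>K z > 1\<close>])
    also have "ennreal (2 / pi) * \<dots> = ennreal (2 / pi * (2 * b * cos z / pi * ((ln (K z + 1) - ln (K z - 1)) / (2 * K z))))"
      using cz b by (subst ennreal_mult', simp, subst ennreal_mult') simp_all
    also have "2 / pi * (2 * b * cos z / pi * ((ln (K z + 1) - ln (K z - 1)) / (2 * K z))) =
        2 / pi\<^sup>2 * ((ln (K z + 1) - ln (K z - 1)) * (b * cos z / K z))"
    proof -
      have "2 / pi * (2 * b * p / pi * (A / (2 * k))) = 2 / pi\<^sup>2 * (A * (b * p / k))" for A p k
        by (simp add: power2_eq_square mult_ac)
      then show ?thesis .
    qed
    also have "ennreal \<dots> = ennreal (2 / pi\<^sup>2) * (ennreal (ln (K z + 1) - ln (K z - 1)) * ennreal (b * cos z / K z))"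
      using cz b \<open>K z > 1\<close> by (subst ennreal_mult', simp, subst ennreal_mult'') simp_all
    finally show ?thesis .
  qed
  have "(\<integral>\<^sup>+z. \<integral>\<^sup>+x. ennreal (1 / (pi * cosh (y - (ln \<bar>cos (pi * x)\<bar> - ln \<bar>cos (pi * z)\<bar>)))) \<partial>unif \<partial>unif) =
      ennreal (2 / pi) * (\<integral>\<^sup>+z. (\<integral>\<^sup>+x. ennreal (1 / (pi * cosh (y - (ln \<bar>cos (pi * x)\<bar> - ln (cos z))))) \<partial>unif) *
        indicator {0<..<pi/2} z \<partial>lborel)"
    by (rule nn_integral_unif_abs_cos) measurable
  also have "(\<integral>\<^sup>+z. (\<integral>\<^sup>+x. ennreal (1 / (pi * cosh (y - (ln \<bar>cos (pi * x)\<bar> - ln (cos z))))) \<partial>unif) *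
        indicator {0<..<pi/2} z \<partial>lborel) = 
      (\<integral>\<^sup>+z. ennreal (2 / pi\<^sup>2) * (ennreal (ln (K z + 1) - ln (K z - 1)) * ennreal (b * cos z / K z) * indicator {0<..<pi/2} z) \<partial>lborel)"
    by (intro nn_integral_cong) (auto simp: indicator_def inner)
  also have "\<dots> = ennreal (2 / pi\<^sup>2) * (\<integral>\<^sup>+z. ennreal (ln (K z + 1) - ln (K z - 1)) * ennreal (b * cos z / K z) * indicator {0<..<pi/2} z \<partial>lborel)"
    by (rule nn_integral_cmult) (unfold K_def, measurable)
  also have "(\<integral>\<^sup>+z. ennreal (ln (K z + 1) - ln (K z - 1)) * ennreal (b * cos z / K z) * indicator {0<..<pi/2} z \<partial>lborel) =
      2 * (\<integral>\<^sup>+u. ennreal (u / (2 * cosh u)) * indicator {- y<..} u \<partial>lborel)"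
    using nn_integral_ln_cos_ratio_substitution[OF b(1)] nn_integral_ln_cos_ratio[OF b] nn_integral_ln_tan[of y]
    by (simp only: K_def b_def)
  also have "ennreal (2 / pi) * (ennreal (2 / pi\<^sup>2) * \<dots>) = ennreal (8 / pi ^ 3) * (\<integral>\<^sup>+u. ennreal (u / (2 * cosh u)) * indicator {- y<..} u \<partial>lborel)"
  proof -
    have "ennreal (2 / pi) * ennreal (2 / pi\<^sup>2) * ennreal 2 = ennreal (8 / pi ^ 3)"
      by (subst ennreal_mult'[symmetric], simp, subst ennreal_mult'[symmetric], simp, simp add: eval_nat_numeral)
    then show ?thesis by (simp add: mult.assoc[symmetric])
  qed
  also have "\<dots> = (\<integral>\<^sup>+u. ennreal (8 / pi ^ 3) * (ennreal (u / (2 * cosh u)) * indicator {- y<..} u) \<partial>lborel)"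
    by (rule nn_integral_cmult[symmetric]) measurable
  also have "\<dots> = (\<integral>\<^sup>+u. ennreal (4 / pi ^ 3 * (u / cosh u)) * indicator {\<bar>y\<bar><..} u \<partial>lborel)"
    using y by (intro nn_integral_cong) (auto simp: indicator_def ennreal_mult'[symmetric])
  finally show ?thesis .
qed

text \<open>
  Exchanging \<open>x\<close> and \<open>z\<close> shows that the density is even.
\<close>

lemma nn_integral_sech_shift:
  "(\<integral>\<^sup>+z. \<integral>\<^sup>+x. ennreal (1 / (pi * cosh (y - (ln \<bar>cos (pi * x)\<bar> - ln \<bar>cos (pi * z)\<bar>)))) \<partial>unif \<partial>unif) =
    (\<integral>\<^sup>+u. ennreal (4 / pi ^ 3 * (u / cosh u)) * indicator {\<bar>y\<bar><..} u \<partial>lborel)"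
proof (cases "y \<le> 0")
  case True
  then show ?thesis by (rule nn_integral_sech_shift_nonpos)
next
  case False
  have flip: "cosh (y - (p - q)) = cosh (- y - (q - p))" for p q :: real
    using cosh_minus[of "y - (p - q)"] by simp
  have "(\<integral>\<^sup>+z. \<integral>\<^sup>+x. ennreal (1 / (pi * cosh (y - (ln \<bar>cos (pi * x)\<bar> - ln \<bar>cos (pi * z)\<bar>)))) \<partial>unif \<partial>unif) =
      (\<integral>\<^sup>+x. \<integral>\<^sup>+z. ennreal (1 / (pi * cosh (- y - (ln \<bar>cos (pi * z)\<bar> - ln \<bar>cos (pi * x)\<bar>)))) \<partial>unif \<partial>unif)"
    unfolding flip by (rule unif_pair.Fubini') measurable
  then show ?thesis using nn_integral_sech_shift_nonpos[of "- y"] False by simp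
qed

section \<open>Hyperbolic integrals and the zeta value\<close>

lemma measurable_sinh [measurable]: "(sinh :: real \<Rightarrow> real) \<in> borel_measurable borel"
  by (intro borel_measurable_continuous_onI continuous_intros)

text \<open>
  The function \<open>(ln (cosh x) - ln (cosh (d - x))) / sinh d\<close> is an antiderivative of the integrand; it
  increases from \<open>- d / sinh d\<close> to \<open>d / sinh d\<close>. The integral is that of the constant function \<open>1\<close> over its range.
\<close>

lemma nn_integral_sech_convolution:
  assumes d: "d \<noteq> 0"
  shows "(\<integral>\<^sup>+x. ennreal (1 / (cosh x * cosh (d - x))) \<partial>lborel) = ennreal (2 * d / sinh d)"
proof -
  define g where "g x = (ln (cosh x) - ln (cosh (d - x))) / sinh d" for x :: real
  have sd: "sinh d \<noteq> 0" using d by simp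
  have lim_top: "((\<lambda>x. ln (cosh x) - ln (cosh (d - x))) \<longlongrightarrow> d) at_top" for d :: real
  proof -
    have eq: "ln (cosh x) - ln (cosh (d - x)) = ln (1 + exp (-2 * x)) - ln (exp (d - 2 * x) + exp (- d))" for x
    proof -
      have 1: "cosh x = (1 + exp (-2 * x)) * (exp x / 2)"
        by (simp add: cosh_def exp_add[symmetric] algebra_simps)
      have 2: "cosh (d - x) = (exp (d - 2 * x) + exp (- d)) * (exp x / 2)"
        by (simp add: cosh_def exp_add[symmetric] algebra_simps)
      have 3: "ln (u * w) - ln (v * w) = ln u - ln v" if "u > 0" "v > 0" "w > 0" for u v w :: real
        using that by (simp add: ln_mult)
      show ?thesis unfolding 1 2 by (intro 3 add_pos_pos) auto
    qed
    have lim: "((\<lambda>x::real. c * exp (- 2 * x)) \<longlongrightarrow> c * 0) at_top" for c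
      by (intro tendsto_mult tendsto_const filterlim_compose[OF exp_at_bot]) real_asymp
    have "((\<lambda>x. ln (1 + 1 * exp (-2 * x)) - ln (exp d * exp (- 2 * x) + exp (- d))) \<longlongrightarrow>
        ln (1 + 1 * 0) - ln (exp d * 0 + exp (- d))) at_top"
      by (intro tendsto_diff tendsto_ln tendsto_add tendsto_const lim) auto
    then show ?thesis unfolding eq by (simp add: exp_add[symmetric])
  qed
  have lim_bot: "((\<lambda>x. ln (cosh x) - ln (cosh (d - x))) \<longlongrightarrow> - d) at_bot"
  proof -
    have flip: "cosh (- d - x) = cosh (d + x)" for x :: real
      using cosh_minus[of "d + x"] by simp
    show ?thesis
      using lim_top[of "- d"] unfolding filterlim_at_bot_mirror flip diff_minus_eq_add cosh_minus .
  qed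
  have lims: "(g \<longlongrightarrow> - d / sinh d) at_bot" "(g \<longlongrightarrow> d / sinh d) at_top"
    unfolding g_def by (intro tendsto_divide tendsto_const lim_bot lim_top sd)+
  have deriv: "(g has_real_derivative 1 / (cosh x * cosh (d - x))) (at x)" for x
  proof -
    have "sinh d = sinh x * cosh (d - x) + cosh x * sinh (d - x)"
      using sinh_add[of x "d - x"] by simp
    then have "sinh x / cosh x + sinh (d - x) / cosh (d - x) = sinh d / (cosh x * cosh (d - x))"
      by (simp add: add_frac_eq mult.commute)
    then have "(sinh x / cosh x + sinh (d - x) / cosh (d - x)) / sinh d = 1 / (cosh x * cosh (d - x))"
      using sd by simp
    moreover have "(g has_real_derivative (sinh x / cosh x + sinh (d - x) / cosh (d - x)) / sinh d) (at x)"
      unfolding g_def by (auto intro!: derivative_eq_intros simp: d)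
    ultimately show ?thesis by simp
  qed
  have "(\<integral>\<^sup>+x. 1 * ennreal (1 / (cosh x * cosh (d - x))) \<partial>lborel) =
      (\<integral>\<^sup>+x. 1 * indicator {- d / sinh d<..<d / sinh d} x \<partial>lborel)"
    by (rule nn_integral_substitution_line[symmetric, OF _ deriv _ _ lims])
      (auto intro!: continuous_intros)
  also have "\<dots> = ennreal (2 * d / sinh d)"
  proof -
    have "0 \<le> d / sinh d" using sinh_real_pos_iff[of d] sinh_real_neg_iff[of d] d
      by (cases d "0::real" rule: linorder_cases) (auto simp: d divide_nonpos_nonpos less_imp_le)
    then show ?thesis by simp
  qed
  finally show ?thesis by simp
qed

lemma summable_inverse_fifth_powers: "summable (\<lambda>n. 1 / real (Suc n) ^ 5)"
  using inverse_power_summable[of 5, where 'a = real] by (subst summable_Suc_iff) (simp add: divide_inverse)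

text \<open>
  Integrating \<open>1 / sinh d = 2 \<Sum> exp (- (2k + 1) d)\<close> term by term against \<open>d\<^sup>4\<close> gives \<open>48 \<Sum> 1 / (2k + 1)\<^sup>5\<close>,
  and the odd terms make up \<open>31/32\<close> of the full series.
\<close>

lemma nn_integral_quartic_csch:
  "(\<integral>\<^sup>+d. ennreal (d ^ 4 / sinh d) * indicator {0<..} d \<partial>lborel) =
     ennreal (93 / 2 * (suminf (\<lambda>n. 1 / real (Suc n) ^ 5)))"
proof -
  have expand: "ennreal (d ^ 4 / sinh d) * indicator {0<..} d =
      (suminf (\<lambda>k. ennreal (2 * d ^ 4 * exp (- (real (2 * k + 1) * d))) * indicator {0<..} d))" for d :: real
  proof (cases "d > 0")
    case True
    define q where "q = exp (- (2 * d))"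
    have q: "0 < q" "q < 1" using True by (auto simp: q_def)
    have term_eq: "2 * d ^ 4 * exp (- (real (2 * k + 1) * d)) = 2 * d ^ 4 * exp (- d) * q ^ k" for k
      by (simp add: q_def exp_of_nat_mult[symmetric] exp_add[symmetric] algebra_simps)
    have sinh_d: "sinh d = (1 - q) / (2 * exp (- d))"
    proof -
      have "(exp d - exp (- d)) * exp (- d) = 1 - q"
        by (simp add: left_diff_distrib q_def exp_add[symmetric])
      then show ?thesis by (simp add: sinh_def field_simps)
    qed
    have val: "d ^ 4 / sinh d = 2 * d ^ 4 * exp (- d) * (1 / (1 - q))"
      unfolding sinh_d using q by simp
    have "(\<lambda>k. 2 * d ^ 4 * exp (- d) * q ^ k) sums (d ^ 4 / sinh d)"
      unfolding val by (intro sums_mult geometric_sums) (use q in auto)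
    then have "(\<lambda>k. 2 * d ^ 4 * exp (- (real (2 * k + 1) * d))) sums (d ^ 4 / sinh d)"
      unfolding term_eq .
    then have "(suminf (\<lambda>k. ennreal (2 * d ^ 4 * exp (- (real (2 * k + 1) * d))))) = ennreal (d ^ 4 / sinh d)"
      by (subst suminf_ennreal2) (auto simp: sums_iff)
    then show ?thesis using True by simp
  qed simp
  have gamma: "(\<integral>\<^sup>+d. ennreal (2 * d ^ 4 * exp (- (real (2 * k + 1) * d))) * indicator {0<..} d \<partial>lborel) =
      ennreal (48 / real (2 * k + 1) ^ 5)" for k
  proof -
    define a where "a = real (2 * k + 1)"
    have a: "a > 0" by (simp add: a_def)
    have "(\<integral>\<^sup>+d. ennreal (2 * d ^ 4 * exp (- (a * d))) * indicator {0<..} d \<partial>lborel) =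
        ennreal (1 / a) * (\<integral>\<^sup>+d. ennreal (2 * (d / a) ^ 4 * exp (- d)) * indicator {0<..} (d / a) \<partial>lborel)"
      using a by (subst nn_integral_real_affine[where c = "1 / a" and t = 0]) auto
    also have "\<dots> = ennreal (1 / a) * (\<integral>\<^sup>+d. ennreal (2 / a ^ 4) * (ennreal (d ^ 4 * exp (- d)) * indicator {0..} d) \<partial>lborel)"
    proof (rule arg_cong2[where f = "(*)"], rule refl, rule nn_integral_cong)
      fix d :: real
      show "ennreal (2 * (d / a) ^ 4 * exp (- d)) * indicator {0<..} (d / a) =
          ennreal (2 / a ^ 4) * (ennreal (d ^ 4 * exp (- d)) * indicator {0..} d)"
        using a by (cases "d = 0")
          (auto simp: indicator_def ennreal_mult'[symmetric] power_divide field_simps zero_less_divide_iff)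
    qed
    also have "\<dots> = ennreal (1 / a) * (ennreal (2 / a ^ 4) * ennreal 24)"
      by (subst nn_integral_cmult, simp, subst nn_intergal_power_times_exp_Ici) (simp add: fact_numeral)
    also have "\<dots> = ennreal (48 / a ^ 5)"
    proof -
      have "ennreal (1 / a) * (ennreal (2 / a ^ 4) * ennreal 24) = ennreal (1 / a * (2 / a ^ 4 * 24))"
        using a by (subst ennreal_mult', simp, subst ennreal_mult') simp_all
      also have "1 / a * (2 / a ^ 4 * 24) = 48 / a ^ 5" by (simp add: eval_nat_numeral)
      finally show ?thesis .
    qed
    finally show ?thesis unfolding a_def .
  qed
  let ?z = "\<lambda>n. 1 / real (Suc n) ^ 5"
  note sz = summable_inverse_fifth_powers
  have odd: "(\<lambda>k. 48 / real (2 * k + 1) ^ 5) sums (93 / 2 * (suminf (\<lambda>n. ?z n)))"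
  proof -
    have "(\<lambda>n. \<Sum>i = n * 2..<n * 2 + 2. ?z i) sums (suminf (\<lambda>n. ?z n))"
      by (rule sums_group) (use sz in \<open>auto simp: summable_sums\<close>)
    moreover have "(\<Sum>i = n * 2..<n * 2 + 2. ?z i) = 1 / real (2 * n + 1) ^ 5 + 1 / 32 * ?z n" for n
    proof -
      have "{n * 2..<n * 2 + 2} = {2 * n, 2 * n + 1}" by auto
      moreover have "real (2 * n + 2) ^ 5 = 32 * real (Suc n) ^ 5"
      proof -
        have "real (2 * n + 2) = 2 * real (Suc n)" by simp
        then show ?thesis by (simp only: power_mult_distrib) simp
      qed
      ultimately show ?thesis by (simp add: add.commute)
    qed
    ultimately have "(\<lambda>n. 1 / real (2 * n + 1) ^ 5 + 1 / 32 * ?z n) sums (suminf (\<lambda>n. ?z n))" by simp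
    from sums_diff[OF this sums_mult[OF summable_sums[OF sz], of "1 / 32"]]
    have "(\<lambda>n. 1 / real (2 * n + 1) ^ 5) sums (31 / 32 * (suminf (\<lambda>n. ?z n)))" by simp
    from sums_mult[OF this, of 48] show ?thesis by simp
  qed
  have "(\<integral>\<^sup>+d. ennreal (d ^ 4 / sinh d) * indicator {0<..} d \<partial>lborel) = (suminf (\<lambda>k. ennreal (48 / real (2 * k + 1) ^ 5)))"
    unfolding expand gamma[symmetric] by (rule nn_integral_suminf) auto
  also have "\<dots> = ennreal (93 / 2 * (suminf (\<lambda>n. ?z n)))"
  proof -
    have "(suminf (\<lambda>k. ennreal (48 / real (2 * k + 1) ^ 5))) = ennreal (suminf (\<lambda>k. 48 / real (2 * k + 1) ^ 5))"
      by (rule suminf_ennreal2[OF _ sums_summable[OF odd]]) simp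
    then show ?thesis by (simp only: sums_unique[OF odd])
  qed
  finally show ?thesis .
qed

lemma nn_integral_cubic_sech_sech:
  "(\<integral>\<^sup>+c. \<integral>\<^sup>+u. ennreal (\<bar>u + c\<bar> ^ 3 / (cosh u * cosh c)) \<partial>lborel \<partial>lborel) =
    ennreal (186 * suminf (\<lambda>n. 1 / real (Suc n) ^ 5))"
proof -
  have "(\<integral>\<^sup>+c. \<integral>\<^sup>+u. ennreal (\<bar>u + c\<bar> ^ 3 / (cosh u * cosh c)) \<partial>lborel \<partial>lborel) =
      (\<integral>\<^sup>+c. \<integral>\<^sup>+d. ennreal (\<bar>d\<bar> ^ 3 / (cosh (d - c) * cosh c)) \<partial>lborel \<partial>lborel)"
  proof (rule nn_integral_cong)
    fix c :: real
    show "(\<integral>\<^sup>+u. ennreal (\<bar>u + c\<bar> ^ 3 / (cosh u * cosh c)) \<partial>lborel) =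
        (\<integral>\<^sup>+d. ennreal (\<bar>d\<bar> ^ 3 / (cosh (d - c) * cosh c)) \<partial>lborel)"
      by (subst nn_integral_real_affine[where c = 1 and t = "- c"]) auto
  qed
  also have "\<dots> = (\<integral>\<^sup>+d. \<integral>\<^sup>+c. ennreal (\<bar>d\<bar> ^ 3 / (cosh (d - c) * cosh c)) \<partial>lborel \<partial>lborel)"
    by (rule lborel_pair.Fubini') measurable
  also have "\<dots> = (\<integral>\<^sup>+d. ennreal (2 * d ^ 4 / sinh \<bar>d\<bar>) \<partial>lborel)"
  proof (rule nn_integral_cong_AE, rule AE_mp[OF AE_lborel_neq[of 0]], rule AE_I2, rule impI)
    fix d :: real assume d: "d \<noteq> 0"
    have "(\<integral>\<^sup>+c. ennreal (\<bar>d\<bar> ^ 3 / (cosh (d - c) * cosh c)) \<partial>lborel) =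
        (\<integral>\<^sup>+c. ennreal (\<bar>d\<bar> ^ 3) * ennreal (1 / (cosh c * cosh (d - c))) \<partial>lborel)"
      by (intro nn_integral_cong) (simp add: ennreal_mult'[symmetric] mult.commute)
    also have "\<dots> = ennreal (\<bar>d\<bar> ^ 3) * ennreal (2 * d / sinh d)"
      by (subst nn_integral_cmult) (simp_all add: nn_integral_sech_convolution[OF d])
    also have "\<dots> = ennreal (\<bar>d\<bar> ^ 3 * (2 * d / sinh d))"
      by (rule ennreal_mult'[symmetric]) simp
    also have "\<bar>d\<bar> ^ 3 * (2 * d / sinh d) = 2 * d ^ 4 / sinh \<bar>d\<bar>"
      by (cases "d < 0") (simp_all add: abs_if eval_nat_numeral)
    finally show "(\<integral>\<^sup>+c. ennreal (\<bar>d\<bar> ^ 3 / (cosh (d - c) * cosh c)) \<partial>lborel) = ennreal (2 * d ^ 4 / sinh \<bar>d\<bar>)" .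
  qed
  also have "\<dots> = 2 * (\<integral>\<^sup>+d. ennreal (2 * d ^ 4 / sinh \<bar>d\<bar>) * indicator {0<..} d \<partial>lborel)"
    by (rule nn_integral_even) simp_all
  also have "(\<integral>\<^sup>+d. ennreal (2 * d ^ 4 / sinh \<bar>d\<bar>) * indicator {0<..} d \<partial>lborel) =
      (\<integral>\<^sup>+d. 2 * (ennreal (d ^ 4 / sinh d) * indicator {0<..} d) \<partial>lborel)"
  proof (rule nn_integral_cong)
    fix d :: real
    have "ennreal (2 * d ^ 4 / sinh d) = 2 * ennreal (d ^ 4 / sinh d)"
      using ennreal_mult'[of 2 "d ^ 4 / sinh d"] by simp
    then show "ennreal (2 * d ^ 4 / sinh \<bar>d\<bar>) * indicator {0<..} d = 2 * (ennreal (d ^ 4 / sinh d) * indicator {0<..} d)"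
      by (auto simp: indicator_def)
  qed
  also have "\<dots> = 2 * ennreal (93 / 2 * (suminf (\<lambda>n. 1 / real (Suc n) ^ 5)))"
    by (subst nn_integral_cmult) (simp_all add: nn_integral_quartic_csch)
  finally show ?thesis
    by (simp add: ennreal_mult'[symmetric] flip: ennreal_numeral)
qed

section \<open>The mean absolute value of the sum of logarithms\<close>

text \<open>
  For \<open>u > 0\<close> this is the integral of \<open>|y + c|\<close> over the window from \<open>-u\<close> to \<open>u\<close>; the closed form extends it
  to an odd function of \<open>u\<close>.
\<close>

definition abs_window :: "real \<Rightarrow> real \<Rightarrow> real" where
  "abs_window u c = ((u + c) * \<bar>u + c\<bar> + (u - c) * \<bar>u - c\<bar>) / 2"

lemma measurable_abs_window [measurable]:
  "(\<lambda>(u, c). abs_window u c) \<in> borel_measurable (borel \<Otimes>\<^sub>M borel)"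
  unfolding abs_window_def by measurable

lemma abs_window_minus: "abs_window (- u) c = - abs_window u c"
proof -
  have "\<bar>- u + c\<bar> = \<bar>u - c\<bar>" "\<bar>- u - c\<bar> = \<bar>u + c\<bar>" by linarith+
  then show ?thesis by (simp add: abs_window_def field_simps)
qed

lemma abs_window_nonneg: "0 \<le> u \<Longrightarrow> 0 \<le> abs_window u c"
proof -
  assume u: "0 \<le> u"
  have mono: "s * \<bar>s\<bar> \<le> t * \<bar>t\<bar>" if "s \<le> t" for s t :: real
  proof (cases "s \<ge> 0")
    case True then show ?thesis using that by (auto intro!: mult_mono)
  next
    case False
    show ?thesis
    proof (cases "t \<ge> 0")
      case True 
      have "s * \<bar>s\<bar> \<le> 0" using False by (intro mult_nonpos_nonneg) auto
      also have "0 \<le> t * \<bar>t\<bar>" using True by simp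
      finally show ?thesis .
    next
      case t: False
      have "(- t) * (- t) \<le> (- s) * (- s)" using that t by (intro mult_mono) auto
      then show ?thesis using t False by (simp add: abs_if)
    qed
  qed
  have "(c - u) * \<bar>c - u\<bar> \<le> (u + c) * \<bar>u + c\<bar>" by (rule mono) (use u in simp)
  moreover have "(u - c) * \<bar>u - c\<bar> = - ((c - u) * \<bar>c - u\<bar>)" by (simp add: abs_minus_commute algebra_simps)
  ultimately show ?thesis by (simp add: abs_window_def)
qed

lemma mult_abs_window_nonneg: "0 \<le> u * abs_window u c"
  using abs_window_nonneg[of u c] abs_window_nonneg[of "- u" c]
  by (cases "0 \<le> u") (auto simp: abs_window_minus intro: mult_nonpos_nonpos)

text \<open>
  Since \<open>|t|\<^sup>3 = t \<cdot> t|t|\<close>, the factors \<open>u\<close> and \<open>c\<close> combine to \<open>u + c\<close> and \<open>u - c\<close> and complete the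
  signed squares in \<open>abs_window\<close> to cubes.
\<close>

lemma abs_window_symmetrized:
  "u * abs_window u c + c * abs_window c u = (\<bar>u + c\<bar> ^ 3 + \<bar>u - c\<bar> ^ 3) / 2"
proof -
  have cube: "\<bar>t\<bar> ^ 3 = t * (t * \<bar>t\<bar>)" for t :: real
    by (simp add: power3_eq_cube abs_if)
  show ?thesis
    unfolding cube abs_window_def add.commute[of c u] abs_minus_commute[of c u] by (simp add: field_simps)
qed

lemma nn_integral_abs_window:
  assumes u: "u > 0"
  shows "(\<integral>\<^sup>+y. ennreal \<bar>y + c\<bar> * indicator {- u<..<u} y \<partial>lborel) = ennreal (abs_window u c)"
proof -
  define F where "F y = (y + c) * \<bar>y + c\<bar> / 2" for y
  have "(\<integral>\<^sup>+y. ennreal \<bar>y + c\<bar> * indicator {- u..u} y \<partial>lborel) = ennreal (F u - F (- u))"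
  proof (rule nn_integral_FTC_Icc)
    fix y :: real
    \<comment> \<open>\<open>t|t| / 2\<close> is differentiable at \<open>0\<close> too, although \<open>|t|\<close> is not\<close>
    have sq: "((\<lambda>t::real. t * \<bar>t\<bar> / 2) has_real_derivative \<bar>t\<bar>) (at t)" for t
    proof (cases t "0::real" rule: linorder_cases)
      case equal
      have "((\<lambda>h::real. ((0 + h) * \<bar>0 + h\<bar> / 2 - 0 * \<bar>0\<bar> / 2) / h) \<longlongrightarrow> 0) (at 0)"
      proof (rule Lim_transform_eventually)
        show "((\<lambda>h::real. \<bar>h\<bar> / 2) \<longlongrightarrow> 0) (at 0)"
          by (rule tendsto_eq_intros refl | simp)+
        show "\<forall>\<^sub>F h::real in at 0. \<bar>h\<bar> / 2 = ((0 + h) * \<bar>0 + h\<bar> / 2 - 0 * \<bar>0\<bar> / 2) / h"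
          by (auto simp: eventually_at_filter)
      qed
      then show ?thesis unfolding equal DERIV_def by simp
    next
      case less
      have "((\<lambda>t::real. - (t * t) / 2) has_real_derivative \<bar>t\<bar>) (at t)"
        using less by (auto intro!: derivative_eq_intros)
      then show ?thesis
        by (rule has_field_derivative_transform_within_open[OF _ open_lessThan[of 0]]) (use less in \<open>auto simp: abs_if\<close>)
    next
      case greater
      have "((\<lambda>t::real. (t * t) / 2) has_real_derivative \<bar>t\<bar>) (at t)"
        using greater by (auto intro!: derivative_eq_intros)
      then show ?thesis
        by (rule has_field_derivative_transform_within_open[OF _ open_greaterThan[of 0]]) (use greater in \<open>auto simp: abs_if\<close>)
    qed
    show "(F has_real_derivative \<bar>y + c\<bar>) (at y)"
      unfolding F_def using sq[of "y + c"] by (simp only: DERIV_shift)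
  qed (use u in auto)
  moreover have "F u - F (- u) = abs_window u c"
  proof -
    have "\<bar>c - u\<bar> = \<bar>u - c\<bar>" by linarith
    then show ?thesis by (simp add: F_def abs_window_def field_simps)
  qed
  moreover have "(\<integral>\<^sup>+y. ennreal \<bar>y + c\<bar> * indicator {- u<..<u} y \<partial>lborel) = (\<integral>\<^sup>+y. ennreal \<bar>y + c\<bar> * indicator {- u..u} y \<partial>lborel)"
    by (rule nn_integral_cong_AE, rule AE_mp[OF AE_lborel_neq[of u]], rule AE_mp[OF AE_lborel_neq[of "- u"]])
      (auto simp: indicator_def)
  ultimately show ?thesis by simp
qed

text \<open>
  With \<open>c = L t\<close> fixed, the density of \<open>L s + R x z\<close> is a mixture over \<open>u > 0\<close> of indicators of windows
  \<open>(-u, u)\<close> with weight proportional to \<open>u / cosh u\<close>, whence the kernel \<open>abs_window u c\<close>. Then \<open>c\<close> is averaged out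
  and the resulting double integral over the plane is symmetrized, first under exchanging \<open>u\<close> and \<open>c\<close> and
  then under \<open>u \<mapsto> -u\<close>.
\<close>

lemma nn_integral_abs_three_logs:
  defines "L \<equiv> \<lambda>s. ln \<bar>cos (pi * s)\<bar> - ln \<bar>sin (pi * s)\<bar>"
    and "R \<equiv> \<lambda>x z. ln \<bar>cos (pi * x)\<bar> - ln \<bar>cos (pi * z)\<bar>"
  shows "(\<integral>\<^sup>+t. \<integral>\<^sup>+z. \<integral>\<^sup>+x. \<integral>\<^sup>+s. ennreal \<bar>L s + L t + R x z\<bar> \<partial>unif \<partial>unif \<partial>unif \<partial>unif) =
    ennreal (186 / pi ^ 4 * suminf (\<lambda>n. 1 / real (Suc n) ^ 5))"
proof -
  have [measurable]: "L \<in> borel_measurable borel" "(\<lambda>(x, z). R x z) \<in> borel_measurable (borel \<Otimes>\<^sub>M borel)"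
    unfolding L_def R_def by measurable
  have fixed_t: "(\<integral>\<^sup>+z. \<integral>\<^sup>+x. \<integral>\<^sup>+s. ennreal \<bar>L s + c + R x z\<bar> \<partial>unif \<partial>unif \<partial>unif) =
      (\<integral>\<^sup>+u. ennreal (2 / pi ^ 3 * (u * abs_window u c / cosh u)) \<partial>lborel)" for c
  proof -
    \<comment> \<open>the variable is \<open>y = L s + R x z\<close>, so that \<open>x\<close> and \<open>z\<close> only occur in the density\<close>
    have "(\<integral>\<^sup>+s. ennreal \<bar>L s + c + R x z\<bar> \<partial>unif) =
        (\<integral>\<^sup>+y. ennreal \<bar>y + c\<bar> * ennreal (1 / (pi * cosh (y - R x z))) \<partial>lborel)" for x z
    proof -
      have "(\<integral>\<^sup>+s. ennreal \<bar>L s + c + R x z\<bar> \<partial>unif) =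
          (\<integral>\<^sup>+v. ennreal \<bar>v + c + R x z\<bar> * ennreal (1 / (pi * cosh v)) \<partial>lborel)"
        unfolding L_def by (rule nn_integral_log_cot) measurable
      also have "\<dots> = (\<integral>\<^sup>+y. ennreal \<bar>y + c\<bar> * ennreal (1 / (pi * cosh (y - R x z))) \<partial>lborel)"
        by (subst nn_integral_real_affine[where c = 1 and t = "- R x z"]) (auto simp: algebra_simps)
      finally show ?thesis .
    qed
    then have "(\<integral>\<^sup>+z. \<integral>\<^sup>+x. \<integral>\<^sup>+s. ennreal \<bar>L s + c + R x z\<bar> \<partial>unif \<partial>unif \<partial>unif) =
        (\<integral>\<^sup>+z. \<integral>\<^sup>+x. \<integral>\<^sup>+y. ennreal \<bar>y + c\<bar> * ennreal (1 / (pi * cosh (y - R x z))) \<partial>lborel \<partial>unif \<partial>unif)"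
      by simp
    also have "\<dots> = (\<integral>\<^sup>+z. \<integral>\<^sup>+y. \<integral>\<^sup>+x. ennreal \<bar>y + c\<bar> * ennreal (1 / (pi * cosh (y - R x z))) \<partial>unif \<partial>lborel \<partial>unif)"
      by (intro nn_integral_cong unif_lborel.Fubini'[symmetric]) measurable
    also have "\<dots> = (\<integral>\<^sup>+y. \<integral>\<^sup>+z. \<integral>\<^sup>+x. ennreal \<bar>y + c\<bar> * ennreal (1 / (pi * cosh (y - R x z))) \<partial>unif \<partial>unif \<partial>lborel)"
      by (rule unif_lborel.Fubini'[symmetric]) measurable
    also have "\<dots> = (\<integral>\<^sup>+y. ennreal \<bar>y + c\<bar> * (\<integral>\<^sup>+z. \<integral>\<^sup>+x. ennreal (1 / (pi * cosh (y - R x z))) \<partial>unif \<partial>unif) \<partial>lborel)"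
      by (simp add: nn_integral_cmult)
    also have "\<dots> = (\<integral>\<^sup>+y. \<integral>\<^sup>+u. ennreal \<bar>y + c\<bar> * (ennreal (4 / pi ^ 3 * (u / cosh u)) * indicator {\<bar>y\<bar><..} u) \<partial>lborel \<partial>lborel)"
      unfolding R_def nn_integral_sech_shift by (intro nn_integral_cong nn_integral_cmult[symmetric]) measurable
    also have "\<dots> = (\<integral>\<^sup>+y. \<integral>\<^sup>+u. ennreal (4 / pi ^ 3 * (u / cosh u)) * (ennreal \<bar>y + c\<bar> * indicator {- u<..<u} y) \<partial>lborel \<partial>lborel)"
      by (intro nn_integral_cong) (auto simp: indicator_def mult.commute)
    also have "\<dots> = (\<integral>\<^sup>+u. \<integral>\<^sup>+y. ennreal (4 / pi ^ 3 * (u / cosh u)) * (ennreal \<bar>y + c\<bar> * indicator {- u<..<u} y) \<partial>lborel \<partial>lborel)"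
      by (rule lborel_pair.Fubini') (measurable, simp add: greaterThanLessThan_iff)
    also have "\<dots> = (\<integral>\<^sup>+u. ennreal (4 / pi ^ 3 * (u / cosh u)) * (\<integral>\<^sup>+y. ennreal \<bar>y + c\<bar> * indicator {- u<..<u} y \<partial>lborel) \<partial>lborel)"
      by (intro nn_integral_cong nn_integral_cmult) measurable
    also have "\<dots> = (\<integral>\<^sup>+u. 2 * (ennreal (2 / pi ^ 3 * (u * abs_window u c / cosh u)) * indicator {0<..} u) \<partial>lborel)"
    proof (rule nn_integral_cong)
      fix u :: real
      show "ennreal (4 / pi ^ 3 * (u / cosh u)) * (\<integral>\<^sup>+y. ennreal \<bar>y + c\<bar> * indicator {- u<..<u} y \<partial>lborel) =
          2 * (ennreal (2 / pi ^ 3 * (u * abs_window u c / cosh u)) * indicator {0<..} u)"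
      proof (cases "u > 0")
        case True
        then show ?thesis
          using abs_window_nonneg[of u c]
          by (simp add: nn_integral_abs_window ennreal_mult'[symmetric] flip: ennreal_numeral)
      next
        case False
        then have "{- u<..<u} = {}" by auto
        then show ?thesis using False by simp
      qed
    qed
    also have "\<dots> = 2 * (\<integral>\<^sup>+u. ennreal (2 / pi ^ 3 * (u * abs_window u c / cosh u)) * indicator {0<..} u \<partial>lborel)"
      by (rule nn_integral_cmult) measurable
    also have "\<dots> = (\<integral>\<^sup>+u. ennreal (2 / pi ^ 3 * (u * abs_window u c / cosh u)) \<partial>lborel)"
      by (rule nn_integral_even[symmetric]) (measurable, simp add: abs_window_minus)
    finally show ?thesis .
  qed
  let ?G = "\<lambda>u c. ennreal (2 / pi ^ 4 * (u * abs_window u c / (cosh u * cosh c)))"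
  let ?Y = "\<lambda>u c. ennreal (1 / pi ^ 4) * ennreal (\<bar>u + c\<bar> ^ 3 / (cosh u * cosh c))"
  have "(\<integral>\<^sup>+t. \<integral>\<^sup>+z. \<integral>\<^sup>+x. \<integral>\<^sup>+s. ennreal \<bar>L s + L t + R x z\<bar> \<partial>unif \<partial>unif \<partial>unif \<partial>unif) =
      (\<integral>\<^sup>+t. \<integral>\<^sup>+u. ennreal (2 / pi ^ 3 * (u * abs_window u (L t) / cosh u)) \<partial>lborel \<partial>unif)"
    unfolding fixed_t ..
  also have "\<dots> = (\<integral>\<^sup>+c. (\<integral>\<^sup>+u. ennreal (2 / pi ^ 3 * (u * abs_window u c / cosh u)) \<partial>lborel) * ennreal (1 / (pi * cosh c)) \<partial>lborel)"
    unfolding L_def by (rule nn_integral_log_cot) measurable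
  also have "\<dots> = (\<integral>\<^sup>+c. \<integral>\<^sup>+u. ?G u c \<partial>lborel \<partial>lborel)"
  proof (rule nn_integral_cong)
    fix c :: real
    have "(\<integral>\<^sup>+u. ennreal (2 / pi ^ 3 * (u * abs_window u c / cosh u)) \<partial>lborel) * ennreal (1 / (pi * cosh c)) =
        (\<integral>\<^sup>+u. ennreal (2 / pi ^ 3 * (u * abs_window u c / cosh u)) * ennreal (1 / (pi * cosh c)) \<partial>lborel)"
      by (rule nn_integral_multc[symmetric]) measurable
    also have "\<dots> = (\<integral>\<^sup>+u. ?G u c \<partial>lborel)"
    proof (rule nn_integral_cong)
      fix u :: real
      have "2 / pi ^ 3 * (u * abs_window u c / cosh u) * (1 / (pi * cosh c)) = 2 / pi ^ 4 * (u * abs_window u c / (cosh u * cosh c))"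
        by (simp add: eval_nat_numeral mult_ac)
      then show "ennreal (2 / pi ^ 3 * (u * abs_window u c / cosh u)) * ennreal (1 / (pi * cosh c)) = ?G u c"
        by (simp only: ennreal_mult''[symmetric] zero_le_divide_1_iff cosh_real_nonneg pi_ge_zero mult_nonneg_nonneg)
    qed
    finally show "(\<integral>\<^sup>+u. ennreal (2 / pi ^ 3 * (u * abs_window u c / cosh u)) \<partial>lborel) * ennreal (1 / (pi * cosh c)) =
      (\<integral>\<^sup>+u. ?G u c \<partial>lborel)" .
  qed
  also have "\<dots> = (\<integral>\<^sup>+c. \<integral>\<^sup>+u. ?Y u c \<partial>lborel \<partial>lborel)" (is "?I = ?J")
  proof -
    \<comment> \<open>twice the integral is the integral of the symmetrized kernel, in which both cubes contribute equally\<close>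
    have swap: "?I = (\<integral>\<^sup>+c. \<integral>\<^sup>+u. ?G c u \<partial>lborel \<partial>lborel)"
      by (rule lborel_pair.Fubini') measurable
    have flip: "(\<integral>\<^sup>+u. ?Y (- u) c \<partial>lborel) = (\<integral>\<^sup>+u. ?Y u c \<partial>lborel)" for c
      by (subst nn_integral_real_affine[where c = "-1" and t = 0 and f = "\<lambda>u. ?Y u c"]) auto
    have "?I + ?I = (\<integral>\<^sup>+c. \<integral>\<^sup>+u. ?G u c \<partial>lborel \<partial>lborel) + (\<integral>\<^sup>+c. \<integral>\<^sup>+u. ?G c u \<partial>lborel \<partial>lborel)"
      by (simp only: swap[symmetric])
    also have "\<dots> = (\<integral>\<^sup>+c. \<integral>\<^sup>+u. ?G u c + ?G c u \<partial>lborel \<partial>lborel)"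
      by (simp add: nn_integral_add)
    also have "\<dots> = (\<integral>\<^sup>+c. \<integral>\<^sup>+u. ?Y u c + ?Y (- u) c \<partial>lborel \<partial>lborel)"
    proof (intro nn_integral_cong)
      fix c u :: real
      have nn: "0 \<le> 2 / pi ^ 4 * (u * abs_window u c / (cosh u * cosh c))" for u c
        using mult_abs_window_nonneg[of u c] by simp
      have "?G u c + ?G c u = ennreal (2 / pi ^ 4 * (u * abs_window u c / (cosh u * cosh c)) + 2 / pi ^ 4 * (c * abs_window c u / (cosh c * cosh u)))"
        by (rule ennreal_plus[OF nn nn, symmetric])
      also have "2 / pi ^ 4 * (u * abs_window u c / (cosh u * cosh c)) + 2 / pi ^ 4 * (c * abs_window c u / (cosh c * cosh u)) =
          2 / pi ^ 4 * ((u * abs_window u c + c * abs_window c u) / (cosh u * cosh c))"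
        by (simp add: add_divide_distrib distrib_left mult.commute)
      also have "\<dots> = 1 / pi ^ 4 * (\<bar>u + c\<bar> ^ 3 / (cosh u * cosh c)) + 1 / pi ^ 4 * (\<bar>u - c\<bar> ^ 3 / (cosh u * cosh c))"
        unfolding abs_window_symmetrized by (simp add: add_divide_distrib mult_ac)
      also have "ennreal \<dots> = ?Y u c + ?Y (- u) c"
        by (subst ennreal_plus) (simp_all add: ennreal_mult'[symmetric] abs_minus_commute[of u c])
      finally show "?G u c + ?G c u = ?Y u c + ?Y (- u) c" .
    qed
    also have "\<dots> = (\<integral>\<^sup>+c. (\<integral>\<^sup>+u. ?Y u c \<partial>lborel) + (\<integral>\<^sup>+u. ?Y (- u) c \<partial>lborel) \<partial>lborel)"
      by (intro nn_integral_cong nn_integral_add) measurable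
    also have "\<dots> = ?J + ?J"
      unfolding flip by (rule nn_integral_add) measurable
    finally have "2 * ?I = 2 * ?J" by (simp only: mult_2)
    then show ?thesis by (simp add: ennreal_mult_cancel_left)
  qed
  also have "?J = ennreal (1 / pi ^ 4) * ennreal (186 * suminf (\<lambda>n. 1 / real (Suc n) ^ 5))"
    unfolding nn_integral_cubic_sech_sech[symmetric] by (simp add: nn_integral_cmult)
  also have "\<dots> = ennreal (186 / pi ^ 4 * suminf (\<lambda>n. 1 / real (Suc n) ^ 5))"
    by (subst ennreal_mult'[symmetric]) simp_all
  finally show ?thesis .
qed

section \<open>The Mahler measure\<close>

text \<open>
  For fixed \<open>z\<close> the circle is invariant under rotation by \<open>z\<close>.
\<close>

lemma nn_integral_unif_unif_rotate:
  fixes G :: "complex \<Rightarrow> complex \<Rightarrow> ennreal"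
  assumes [measurable]: "(\<lambda>(y, z). G y z) \<in> borel_measurable (borel \<Otimes>\<^sub>M borel)"
  shows "(\<integral>\<^sup>+y. \<integral>\<^sup>+z. G (circ y) (circ z) \<partial>unif \<partial>unif) =
    (\<integral>\<^sup>+y. \<integral>\<^sup>+z. G (circ y * circ z) (circ z) \<partial>unif \<partial>unif)"
proof -
  have "(\<integral>\<^sup>+y. \<integral>\<^sup>+z. G (circ y) (circ z) \<partial>unif \<partial>unif) = (\<integral>\<^sup>+z. \<integral>\<^sup>+y. G (circ y) (circ z) \<partial>unif \<partial>unif)"
    by (rule unif_pair.Fubini'[symmetric]) measurable
  also have "\<dots> = (\<integral>\<^sup>+z. \<integral>\<^sup>+y. G (circ y * circ z) (circ z) \<partial>unif \<partial>unif)"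
  proof (rule nn_integral_cong_AE)
    have "AE z in unif. z \<in> {0..1}"
      unfolding unif_def by (subst AE_density) (auto simp: indicator_def)
    then show "AE z in unif. (\<integral>\<^sup>+y. G (circ y) (circ z) \<partial>unif) = (\<integral>\<^sup>+y. G (circ y * circ z) (circ z) \<partial>unif)"
    proof eventually_elim
      case (elim z)
      then show ?case
        using nn_integral_unif_rotate[of "\<lambda>y. G (circ y) (circ z)" z] by (simp add: circ_add)
    qed
  qed
  also have "\<dots> = (\<integral>\<^sup>+y. \<integral>\<^sup>+z. G (circ y * circ z) (circ z) \<partial>unif \<partial>unif)"
    by (rule unif_pair.Fubini') measurable
  finally show ?thesis .
qed

text \<open>
  The polynomial is bounded by \<open>16\<close> on the torus. Let \<open>p = ln |A|\<close> and \<open>q = ln |B (1 + y)|\<close>, with \<open>A\<close> and \<open>B\<close>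
  the products of factors in \<open>v, w, x\<close> and in \<open>v, w\<close>. After the rotation and Jensen's formula in \<open>z\<close>, the
  integrand is \<open>ln 16 - max p q\<close>; adding \<open>|p - q| / 2\<close> turns it into \<open>ln 16 - (p + q) / 2\<close>, a sum of functions of one
  variable each, whose mean is \<open>ln 16\<close>. So the two integrals add up to \<open>ln 16\<close>, and that of \<open>|p - q| / 2\<close> is
  known from \<open>nn_integral_abs_three_logs\<close>.
\<close>

lemma nn_integral_ln_norm_polynomial:
  shows "(\<integral>\<^sup>+w. \<integral>\<^sup>+x. \<integral>\<^sup>+v. \<integral>\<^sup>+y. \<integral>\<^sup>+z. ennreal (ln 16 - ln (norm ((1 + circ v) * (1 + circ w) * (1 + circ x) +
      (1 - circ v) * (1 - circ w) * (circ y + circ z)))) \<partial>unif \<partial>unif \<partial>unif \<partial>unif \<partial>unif) =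
    ennreal (ln 16 - 93 / pi ^ 4 * suminf (\<lambda>n. 1 / real (Suc n) ^ 5))" (is "?N = ennreal (ln 16 - ?m)")
    and "93 / pi ^ 4 * suminf (\<lambda>n. 1 / real (Suc n) ^ 5) \<le> ln 16"
proof -
  define lc where "lc t = ln \<bar>cos (pi * t)\<bar>" for t
  define ls where "ls t = ln \<bar>sin (pi * t)\<bar>" for t
  have [measurable]: "lc \<in> borel_measurable borel" "ls \<in> borel_measurable borel"
    unfolding lc_def ls_def by measurable
  define S where "S v w x y = (lc v - ls v) + (lc w - ls w) + (lc x - lc y)" for v w x y
  let ?A = "\<lambda>v w x. (1 + circ v) * (1 + circ w) * (1 + circ x)"
  let ?B = "\<lambda>v w. (1 - circ v) * (1 - circ w)"
  define J where "J v w x y = (\<integral>\<^sup>+z. ennreal (ln 16 - ln (norm (?A v w x + ?B v w * (1 + circ y) * circ z))) \<partial>unif)" for v w x y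
  have [measurable (raw)]: "(\<lambda>t. S (f0 t) (f1 t) (f2 t) (f3 t)) \<in> borel_measurable M"
    if [measurable]: "f0 \<in> borel_measurable M" "f1 \<in> borel_measurable M" "f2 \<in> borel_measurable M" "f3 \<in> borel_measurable M"
    for f0 f1 f2 f3 and M :: "'b measure"
    unfolding S_def by measurable
  have [measurable (raw)]: "(\<lambda>t. J (f0 t) (f1 t) (f2 t) (f3 t)) \<in> borel_measurable M"
    if [measurable]: "f0 \<in> borel_measurable M" "f1 \<in> borel_measurable M" "f2 \<in> borel_measurable M" "f3 \<in> borel_measurable M"
    for f0 f1 f2 f3 and M :: "'b measure"
    unfolding J_def by measurable
  have N: "?N = (\<integral>\<^sup>+w. \<integral>\<^sup>+x. \<integral>\<^sup>+v. \<integral>\<^sup>+y. J v w x y \<partial>unif \<partial>unif \<partial>unif \<partial>unif)"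
  proof (rule nn_integral_cong, rule nn_integral_cong, rule nn_integral_cong)
    fix w x v
    have "(\<integral>\<^sup>+y. \<integral>\<^sup>+z. ennreal (ln 16 - ln (norm (?A v w x + ?B v w * (circ y + circ z)))) \<partial>unif \<partial>unif) =
        (\<integral>\<^sup>+y. \<integral>\<^sup>+z. ennreal (ln 16 - ln (norm (?A v w x + ?B v w * (circ y * circ z + circ z)))) \<partial>unif \<partial>unif)"
      by (rule nn_integral_unif_unif_rotate) measurable
    also have "\<dots> = (\<integral>\<^sup>+y. J v w x y \<partial>unif)"
      unfolding J_def by (simp add: algebra_simps)
    finally show "(\<integral>\<^sup>+y. \<integral>\<^sup>+z. ennreal (ln 16 - ln (norm (?A v w x + ?B v w * (circ y + circ z)))) \<partial>unif \<partial>unif) =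
      (\<integral>\<^sup>+y. J v w x y \<partial>unif)" .
  qed
  have D: "(\<integral>\<^sup>+w. \<integral>\<^sup>+x. \<integral>\<^sup>+v. \<integral>\<^sup>+y. ennreal (\<bar>S v w x y\<bar> / 2) \<partial>unif \<partial>unif \<partial>unif \<partial>unif) = ennreal ?m"
  proof -
    have "(\<integral>\<^sup>+w. \<integral>\<^sup>+x. \<integral>\<^sup>+v. \<integral>\<^sup>+y. ennreal (\<bar>S v w x y\<bar> / 2) \<partial>unif \<partial>unif \<partial>unif \<partial>unif) =
        (\<integral>\<^sup>+w. \<integral>\<^sup>+x. \<integral>\<^sup>+y. \<integral>\<^sup>+v. ennreal (\<bar>S v w x y\<bar> / 2) \<partial>unif \<partial>unif \<partial>unif \<partial>unif)"
      by (rule nn_integral_cong, rule nn_integral_cong, rule unif_pair.Fubini') measurable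
    also have "\<dots> = (\<integral>\<^sup>+w. \<integral>\<^sup>+y. \<integral>\<^sup>+x. \<integral>\<^sup>+v. ennreal (\<bar>S v w x y\<bar> / 2) \<partial>unif \<partial>unif \<partial>unif \<partial>unif)"
      by (rule nn_integral_cong, rule unif_pair.Fubini') measurable
    also have "\<dots> = (\<integral>\<^sup>+w. \<integral>\<^sup>+y. \<integral>\<^sup>+x. \<integral>\<^sup>+v. ennreal (1 / 2) * ennreal \<bar>S v w x y\<bar> \<partial>unif \<partial>unif \<partial>unif \<partial>unif)"
      by (intro nn_integral_cong, subst ennreal_mult'[symmetric]) simp_all
    also have "\<dots> = ennreal (1 / 2) * (\<integral>\<^sup>+w. \<integral>\<^sup>+y. \<integral>\<^sup>+x. \<integral>\<^sup>+v. ennreal \<bar>S v w x y\<bar> \<partial>unif \<partial>unif \<partial>unif \<partial>unif)"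
      by (simp add: nn_integral_cmult)
    also have "(\<integral>\<^sup>+w. \<integral>\<^sup>+y. \<integral>\<^sup>+x. \<integral>\<^sup>+v. ennreal \<bar>S v w x y\<bar> \<partial>unif \<partial>unif \<partial>unif \<partial>unif) =
        ennreal (186 / pi ^ 4 * suminf (\<lambda>n. 1 / real (Suc n) ^ 5))"
      unfolding S_def lc_def ls_def by (rule nn_integral_abs_three_logs)
    also have "ennreal (1 / 2) * \<dots> = ennreal (1 / 2 * (186 / pi ^ 4 * suminf (\<lambda>n. 1 / real (Suc n) ^ 5)))"
      by (rule ennreal_mult'[symmetric]) simp
    finally show ?thesis by simp
  qed
  \<comment> \<open>The logarithms of \<open>|cos|\<close> and \<open>|sin|\<close> are nonpositive with mean \<open>- ln 2\<close>, so \<open>h\<close> and \<open>k\<close> have mean \<open>ln 2 / 2\<close>.\<close>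
  define h where "h t = ennreal (- lc t / 2)" for t
  define k where "k t = ennreal (- ls t / 2)" for t
  have [measurable]: "h \<in> borel_measurable borel" "k \<in> borel_measurable borel"
    unfolding h_def k_def by measurable
  have le0: "lc t \<le> 0" "ls t \<le> 0" for t
    unfolding lc_def ls_def by (cases "cos (pi * t) = 0"; cases "sin (pi * t) = 0"; simp)+
  have hk: "integral\<^sup>N unif h = ennreal (ln 2 / 2)" "integral\<^sup>N unif k = ennreal (ln 2 / 2)"
  proof -
    have *: "(\<integral>\<^sup>+t. ennreal (- f t / 2) \<partial>unif) = ennreal (ln 2 / 2)"
      if "has_bochner_integral unif f (- ln 2)" "\<And>t. f t \<le> 0" for f
    proof -
      have "has_bochner_integral unif (\<lambda>t. - f t / 2) (- (- ln 2) / 2)"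
        by (intro has_bochner_integral_divide_zero has_bochner_integral_minus that(1)) 
      then have int: "integrable unif (\<lambda>t. - f t / 2)" "(LINT t|unif. - f t / 2) = ln 2 / 2"
        unfolding has_bochner_integral_iff minus_minus by blast+
      have "(\<integral>\<^sup>+t. ennreal (- f t / 2) \<partial>unif) = ennreal (LINT t|unif. - f t / 2)"
        by (rule nn_integral_eq_integral[OF int(1)]) (use that(2) in auto)
      then show ?thesis unfolding int(2) .
    qed
    show "integral\<^sup>N unif h = ennreal (ln 2 / 2)" "integral\<^sup>N unif k = ennreal (ln 2 / 2)"
      unfolding h_def k_def
      using *[of lc] *[of ls] le0 has_bochner_integral_ln_cos[folded lc_def] has_bochner_integral_ln_sin[folded ls_def]
      by blast+
  qed
  have pointwise: "J v w x y + ennreal (\<bar>S v w x y\<bar> / 2) =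
      ennreal (ln 2) + h v + k v + h w + k w + h x + h y"
    if nz: "cos (pi * v) \<noteq> 0 \<and> sin (pi * v) \<noteq> 0" "cos (pi * w) \<noteq> 0 \<and> sin (pi * w) \<noteq> 0"
      "cos (pi * x) \<noteq> 0 \<and> sin (pi * x) \<noteq> 0" "cos (pi * y) \<noteq> 0 \<and> sin (pi * y) \<noteq> 0" for v w x y
  proof -
    define a where "a = ?A v w x"
    define b where "b = ?B v w * (1 + circ y)"
    have na: "norm a = 8 * (\<bar>cos (pi * v)\<bar> * \<bar>cos (pi * w)\<bar> * \<bar>cos (pi * x)\<bar>)"
      unfolding a_def by (simp add: norm_mult norm_one_plus_circ)
    have nb: "norm b = 8 * (\<bar>sin (pi * v)\<bar> * \<bar>sin (pi * w)\<bar> * \<bar>cos (pi * y)\<bar>)"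
      unfolding b_def by (simp add: norm_mult norm_one_plus_circ norm_one_minus_circ)
    have ab: "a \<noteq> 0" "b \<noteq> 0" using na nb nz by auto
    have ln_a: "ln (norm a) = ln 8 + (lc v + lc w + lc x)"
      unfolding na lc_def using nz by (simp add: ln_mult)
    have ln_b: "ln (norm b) = ln 8 + (ls v + ls w + lc y)"
      unfolding nb lc_def ls_def using nz by (simp add: ln_mult)
    have bound: "norm a \<le> 8" "norm b \<le> 8"
      unfolding na nb by (simp_all add: mult_le_one)
    have ln16: "ln 16 = ln 8 + ln (2::real)"
      using ln_mult[of 8 "2::real"] by simp
    have "J v w x y = ennreal (ln 16 - max (ln (norm a)) (ln (norm b)))"
      unfolding J_def a_def[symmetric] b_def[symmetric]
      by (rule nn_integral_jensen) (use ab bound in auto)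
    moreover have "max (ln (norm a)) (ln (norm b)) \<le> ln 16"
      using bound ab by (auto intro!: ln_mono)
    ultimately have "J v w x y + ennreal (\<bar>S v w x y\<bar> / 2) =
        ennreal (ln 16 - max (ln (norm a)) (ln (norm b)) + \<bar>S v w x y\<bar> / 2)"
      by (subst ennreal_plus) auto
    also have "ln 16 - max (ln (norm a)) (ln (norm b)) + \<bar>S v w x y\<bar> / 2 =
        ln 2 + - lc v / 2 + - ls v / 2 + - lc w / 2 + - ls w / 2 + - lc x / 2 + - lc y / 2"
      unfolding ln_a ln_b ln16 S_def by (simp add: max_def abs_if field_simps)
    also have "ennreal \<dots> = ennreal (ln 2) + h v + k v + h w + k w + h x + h y"
    proof -
      have plus: "ennreal (c + p1 + p2 + p3 + p4 + p5 + p6) =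
          ennreal c + ennreal p1 + ennreal p2 + ennreal p3 + ennreal p4 + ennreal p5 + ennreal p6"
        if "0 \<le> c" "0 \<le> p1" "0 \<le> p2" "0 \<le> p3" "0 \<le> p4" "0 \<le> p5" "0 \<le> p6" for c p1 p2 p3 p4 p5 p6
        using that by simp
      show ?thesis
        unfolding h_def k_def by (rule plus) (use le0 in auto)
    qed
    finally show ?thesis .
  qed
  let ?e = "ennreal (ln 2 / 2)"
  have "?N + ennreal ?m = (\<integral>\<^sup>+w. \<integral>\<^sup>+x. \<integral>\<^sup>+v. \<integral>\<^sup>+y. J v w x y + ennreal (\<bar>S v w x y\<bar> / 2) \<partial>unif \<partial>unif \<partial>unif \<partial>unif)"
    unfolding N D[symmetric] by (simp add: nn_integral_add)
  also have "\<dots> = (\<integral>\<^sup>+w. \<integral>\<^sup>+x. \<integral>\<^sup>+v. \<integral>\<^sup>+y. ennreal (ln 2) + h v + k v + h w + k w + h x + h y \<partial>unif \<partial>unif \<partial>unif \<partial>unif)"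
    by ((rule nn_integral_cong_AE, rule AE_mp[OF AE_unif_cos_sin_neq], rule AE_I2, rule impI)+, rule pointwise)
  also have "\<dots> = ennreal (ln 2) + (?e + (?e + (?e + (?e + (?e + ?e)))))"
    by (simp add: nn_integral_add hk unif.emeasure_space_1[simplified] add_ac)
  also have "\<dots> = ennreal (ln 16)"
  proof -
    have "ln 16 = 4 * ln (2::real)" using ln_realpow[of 2 4] by simp
    then show ?thesis by (simp flip: ennreal_plus)
  qed
  finally have sum: "?N + ennreal ?m = ennreal (ln 16)" .
  have m: "0 \<le> ?m"
    by (intro mult_nonneg_nonneg suminf_nonneg summable_inverse_fifth_powers) auto
  have "?N = ?N + ennreal ?m - ennreal ?m" by simp
  also have "\<dots> = ennreal (ln 16 - ?m)" unfolding sum by (rule ennreal_minus[OF m])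
  finally show "?N = ennreal (ln 16 - ?m)" .
  have "ennreal ?m \<le> ?N + ennreal ?m" by simp
  then show "?m \<le> ln 16" unfolding sum by (subst (asm) ennreal_le_iff) simp_all
qed

theorem theorem21:
  "let v = pvar 0; w = pvar 1; x = pvar 2; y = pvar 3; z = pvar 4
   in of_real pi ^ 4 *
        mahler_measure 5 ((1 + v) * (1 + w) * (1 + x) + (1 - v) * (1 - w) * (y + z)) = 93 * zeta 5"
proof -
  define Z where "Z = suminf (\<lambda>n. 1 / real (Suc n) ^ 5)"
  define p where "p a b c d e = (1 + circ a) * (1 + circ b) * (1 + circ c) + (1 - circ a) * (1 - circ b) * (circ d + circ e)"
    for a b c d e
  define f where "f t = ln (norm (p (t 0) (t 1) (t 2) (t 3) (t 4)))" for t :: "nat \<Rightarrow> real"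
  let ?P = "(1 + pvar 0) * (1 + pvar 1) * (1 + pvar 2) + (1 - pvar 0) * (1 - pvar 1) * (pvar 3 + pvar 4)"
  let ?Q = "Pi\<^sub>M {..<5::nat} (\<lambda>_. lborel :: real measure)"
  let ?box = "{..<5::nat} \<rightarrow>\<^sub>E {0..1::real}"
  have [measurable (raw)]: "(\<lambda>t. p (f0 t) (f1 t) (f2 t) (f3 t) (f4 t)) \<in> borel_measurable M"
    if [measurable]: "f0 \<in> borel_measurable M" "f1 \<in> borel_measurable M" "f2 \<in> borel_measurable M"
      "f3 \<in> borel_measurable M" "f4 \<in> borel_measurable M" for f0 f1 f2 f3 f4 and M :: "'b measure"
    unfolding p_def by measurable
  have comp [measurable]: "(\<lambda>t. t j) \<in> borel_measurable ?Q" if "j < 5" for j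
    using measurable_component_singleton[of j "{..<5}" "\<lambda>_. lborel :: real measure"] that by simp
  have f_meas [measurable]: "f \<in> borel_measurable ?Q"
    unfolding f_def by (intro borel_measurable_ln measurable_compose[OF _ borel_measurable_norm]) measurable
  have box [measurable]: "?box \<in> sets ?Q"
    by (rule sets_PiM_I_finite) auto
  have bound: "norm (p a b c d e) \<le> 16" for a b c d e
  proof -
    have "norm (circ d + circ e) \<le> 2" "norm (1 + circ t) \<le> 2" "norm (1 - circ t) \<le> 2" for t
      using norm_triangle_ineq[of "circ d" "circ e"] norm_triangle_ineq[of 1 "circ t"]
        norm_triangle_ineq4[of 1 "circ t"] by simp_all
    then have "norm ((1 + circ a) * (1 + circ b) * (1 + circ c)) \<le> 2 * 2 * 2"
      "norm ((1 - circ a) * (1 - circ b) * (circ d + circ e)) \<le> 2 * 2 * 2"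
      unfolding norm_mult by (intro mult_mono; simp)+
    then show ?thesis unfolding p_def by (intro order_trans[OF norm_triangle_ineq]) simp
  qed
  have f_le: "f t \<le> ln 16" for t
    unfolding f_def using bound
    by (cases "p (t 0) (t 1) (t 2) (t 3) (t 4) = 0") (auto intro!: ln_mono)
  have nn: "(\<integral>\<^sup>+t. ennreal (ln 16 - f t) * indicator ?box t \<partial>?Q) = ennreal (ln 16 - 93 / pi ^ 4 * Z)"
    unfolding f_def Z_def nn_integral_ln_norm_polynomial(1)[symmetric] p_def[symmetric]
    by (rule nn_integral_unit_cube_5) measurable
  have "(\<integral>\<^sup>+t. 1 * indicator ?box t \<partial>?Q) = 1"
    by (subst nn_integral_unit_cube_5) (simp_all add: unif.emeasure_space_1[simplified])
  then have one: "emeasure ?Q ?box = 1" by simp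
  \<comment> \<open>The finite integral of \<open>ln 16 - f \<ge> 0\<close> gives the integrability of \<open>f\<close> on the cube, which has measure \<open>1\<close>.\<close>
  have "has_bochner_integral ?Q (\<lambda>t. (ln 16 - f t) * indicator ?box t) (ln 16 - 93 / pi ^ 4 * Z)"
  proof (rule has_bochner_integral_nn_integral)
    show "(\<integral>\<^sup>+t. ennreal ((ln 16 - f t) * indicator ?box t) \<partial>?Q) = ennreal (ln 16 - 93 / pi ^ 4 * Z)"
      unfolding nn[symmetric] by (intro nn_integral_cong) (auto simp: indicator_def)
    show "0 \<le> ln 16 - 93 / pi ^ 4 * Z"
      using nn_integral_ln_norm_polynomial(2) unfolding Z_def by simp
  qed (use f_le in \<open>auto simp: indicator_def\<close>)
  moreover have "has_bochner_integral ?Q (\<lambda>t. ln 16 * indicator ?box t) (ln 16 * 1 :: real)"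
  proof -
    have "has_bochner_integral ?Q (indicator ?box) (1::real)"
      using has_bochner_integral_real_indicator[OF box] one by (simp add: measure_def)
    then show ?thesis by (intro has_bochner_integral_mult_right)
  qed
  ultimately have "has_bochner_integral ?Q (\<lambda>t. ln 16 * indicator ?box t - (ln 16 - f t) * indicator ?box t)
      (ln 16 * 1 - (ln 16 - 93 / pi ^ 4 * Z))"
    by (rule has_bochner_integral_diff[rotated])
  then have "has_bochner_integral ?Q (\<lambda>t. indicator ?box t *\<^sub>R f t) (93 / pi ^ 4 * Z)"
    by (simp add: algebra_simps)
  then have "(LINT t:?box|?Q. f t) = 93 / pi ^ 4 * Z"
    unfolding set_lebesgue_integral_def by (rule has_bochner_integral_integral_eq)
  moreover have "mahler_measure 5 ?P = of_real (LINT t:?box|?Q. f t)"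
    unfolding mahler_measure_eq f_def p_def circ_def by simp
  moreover have "zeta 5 = of_real Z"
  proof -
    have "(\<lambda>n. of_real (1 / real (Suc n) ^ 5) :: complex) = (\<lambda>n. 1 / of_nat (Suc n) powr 5)"
    proof
      fix n
      have "(of_nat (Suc n) :: complex) powr 5 = of_nat (Suc n) ^ 5"
        using powr_nat'[of "of_nat (Suc n)" 5] by simp
      then show "of_real (1 / real (Suc n) ^ 5) = (1 / of_nat (Suc n) powr 5 :: complex)" by simp
    qed
    then show ?thesis
      unfolding zeta_def Z_def suminf_of_real[OF summable_inverse_fifth_powers] by simp
  qed
  ultimately show ?thesis by simp
qed

end
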